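(* Let $A$ be a finite-dimensional perm algebra and $\Delta:A\to A\otimes A$ a linear map such that $\Delta^{\ast}:A^{\ast}\otimes A^{\ast}\to A^{\ast}$ defines a perm algebra structure on $A^{\ast}$. Then the following conditions are equivalent: (i) $(A,\Delta)$ is a perm bialgebra; (ii) $(A,A^{\ast},\mathfrak{r}_A^{\ast}-\mathfrak{l}_A^{\ast},\mathfrak{r}_A^{\ast},\mathfrak{r}_{A^{\ast}}^{\ast}-\mathfrak{l}_{A^{\ast}}^{\ast},\mathfrak{r}_{A^{\ast}}^{\ast})$ is a matched pair of perm algebras; (iii) $(A\oplus A^{\ast},A,A^{\ast})$ is a standard Manin triple with respect to the bilinear form $\widehat\omega$.
   Context: All vector spaces are finite-dimensional over a field $\mathbb{K}$ of characteristic zero. A perm algebra is a vector space with a bilinear product satisfying $(a_1a_2)a_3=a_1(a_2a_3)=a_1(a_3a_2)$ (no unit is required). $\langle\ ,\ \rangle$ is the pairing between a space and its dual. The product on $A^{\ast}$ defined by $\Delta^{\ast}$ is $\langle b_1b_2,a\rangle=\langle b_1\otimes b_2,\Delta(a)\rangle$. $\tau(x\otimes y)=y\otimes x$. For a perm algebra $P$, $\mathfrak{l}_P(x)(y)=xy$ and $\mathfrak{r}_P(x)(y)=yx$; the maps $\mathfrak{l}_P^{\ast},\mathfrak{r}_P^{\ast}:P\to\mathrm{End}(P^{\ast})$ are $\langle\mathfrak{l}_P^{\ast}(x)(u),y\rangle=\langle u,xy\rangle$, $\langle\mathfrak{r}_P^{\ast}(x)(u),y\rangle=\langle u,yx\rangle$.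 For $P=A^{\ast}$, $(A^{\ast})^{\ast}$ is identified with $A$. Perm bialgebra: $(A,\Delta)$ such that $(\Delta\otimes\mathrm{id})\Delta=(\mathrm{id}\otimes\Delta)\Delta=(\mathrm{id}\otimes\tau\Delta)\Delta$ and for all $a_1,a_2\in A$: $$\Delta(a_1a_2)-\tau\Delta(a_1a_2)=\Delta(a_2a_1)-\tau\Delta(a_2a_1)$$ $$=(\mathfrak{r}_A(a_2)\otimes\mathrm{id})\Delta(a_1)-\tau(\mathrm{id}\otimes\mathfrak{r}_A(a_2))\Delta(a_1)+(\mathrm{id}\otimes\mathfrak{r}_A(a_1))\Delta(a_2)-\tau(\mathfrak{r}_A(a_1)\otimes\mathrm{id})\Delta(a_2),$$ and $$\Delta(a_1a_2)=(\mathfrak{l}_A(a_1)\otimes\mathrm{id})\Delta(a_2)+(\mathrm{id}\otimes\mathfrak{r}_A(a_2))\Delta(a_1)-(\mathrm{id}\otimes\mathfrak{l}_A(a_2))\Delta(a_1)$$ $$=(\mathfrak{l}_A(a_1)\otimes\mathrm{id})\Delta(a_2)-\tau(\mathrm{id}\otimes\mathfrak{l}_A(a_1))\Delta(a_2)+(\mathrm{id}\otimes\mathfrak{r}_A(a_2))\Delta(a_1)$$ $$=(\mathfrak{r}_A(a_2)\otimes\mathrm{id})\Delta(a_1)+(\mathrm{id}\otimes\mathfrak{r}_A(a_1))\Delta(a_2)-(\mathrm{id}\otimes\mathfrak{l}_A(a_1))\Delta(a_2)-\tau(\mathfrak{r}_A(a_1)\otimes\mathrm{id})\Delta(a_2)+\tau(\mathfrak{l}_A(a_1)\otimes\mathrm{id})\Delta(a_2).$$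 Matched pair: for perm algebras $A,B$ and linear maps $\mathfrak{l}_1,\mathfrak{r}_1:A\to\mathrm{End}(B)$, $\mathfrak{l}_2,\mathfrak{r}_2:B\to\mathrm{End}(A)$, $(A,B,\mathfrak{l}_1,\mathfrak{r}_1,\mathfrak{l}_2,\mathfrak{r}_2)$ is a matched pair if $A\oplus B$ with product $$(a_1,b_1)\ast(a_2,b_2)=\big(a_1a_2+\mathfrak{l}_2(b_1)(a_2)+\mathfrak{r}_2(b_2)(a_1),\ b_1b_2+\mathfrak{l}_1(a_1)(b_2)+\mathfrak{r}_1(a_2)(b_1)\big)$$ is a perm algebra. Standard Manin triple: $(A\oplus A^{\ast},A,A^{\ast})$ is a standard Manin triple with respect to $\widehat\omega$ if there is a perm algebra structure on $A\oplus A^{\ast}$ such that $A$ and $A^{\ast}$ (with their given products) are perm subalgebras and the bilinear form $\widehat\omega((a_1,b_1),(a_2,b_2))=\langle a_1,b_2\rangle-\langle a_2,b_1\rangle$ is invariant. A bilinear form $\omega$ on a perm algebra is invariant if $\omega(xy,z)=\omega(y,zx)-\omega(y,xz)$ for all $x,y,z$. *)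

theory Defs
  imports "HOL-Analysis.Product_Vector" "HOL-Library.Function_Algebras"
begin

section \<open>Vector spaces of functions, duals\<close>

definition fun_scale :: "'k::field \<Rightarrow> ('x \<Rightarrow> 'k) \<Rightarrow> 'x \<Rightarrow> 'k" where
  "fun_scale c f = (\<lambda>x. c * f x)"

text \<open>The dual space is a subspace of the space of all functions, with the pointwise operations.\<close>

definition dual :: "('k::field \<Rightarrow> 'a::ab_group_add \<Rightarrow> 'a) \<Rightarrow> ('a \<Rightarrow> 'k) set" where
  "dual s = {f. Vector_Spaces.linear s (*) f}"

text \<open>
  The identification of the bidual with the space itself: the vector whose evaluation
  functional is \<open>F\<close>. It exists and is unique when the space is finite-dimensional and
  \<open>F\<close> is linear on the dual; see \<open>of_bidual_eqI\<close> and \<open>eval_of_bidual\<close> below.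
\<close>

definition of_bidual ::
  "('k::field \<Rightarrow> 'a::ab_group_add \<Rightarrow> 'a) \<Rightarrow> (('a \<Rightarrow> 'k) \<Rightarrow> 'k) \<Rightarrow> 'a" where
  "of_bidual s F = (THE a. \<forall>f\<in>dual s. f a = F f)"

section \<open>Tensor products\<close>

definition bilin :: "('k::field \<Rightarrow> 'a::ab_group_add \<Rightarrow> 'a) \<Rightarrow> ('a \<Rightarrow> 'a \<Rightarrow> 'k) \<Rightarrow> bool" where
  "bilin s \<beta> \<longleftrightarrow>
     (\<forall>x. Vector_Spaces.linear s (*) (\<lambda>y. \<beta> x y)) \<and>
     (\<forall>y. Vector_Spaces.linear s (*) (\<lambda>x. \<beta> x y))"

definition trilin ::
  "('k::field \<Rightarrow> 'a::ab_group_add \<Rightarrow> 'a) \<Rightarrow> ('a \<Rightarrow> 'a \<Rightarrow> 'a \<Rightarrow> 'k) \<Rightarrow> bool" where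
  "trilin s \<gamma> \<longleftrightarrow>
     (\<forall>y z. Vector_Spaces.linear s (*) (\<lambda>x. \<gamma> x y z)) \<and>
     (\<forall>x z. Vector_Spaces.linear s (*) (\<lambda>y. \<gamma> x y z)) \<and>
     (\<forall>x y. Vector_Spaces.linear s (*) (\<lambda>z. \<gamma> x y z))"

text \<open>
  \<open>A \<otimes> A\<close> is realised inside the dual of the space of bilinear forms on \<open>A\<close>:
  the pure tensor \<open>a \<otimes> b\<close> sends a bilinear form \<open>\<beta>\<close> to \<open>\<beta> a b\<close>, and \<open>A \<otimes> A\<close> is the span of the
  pure tensors. Functions that are not bilinear forms are sent to 0, so that equality of
  tensors is equality in HOL. The universal property is \<open>tensor2_universal\<close> below.
  Likewise, \<open>A \<otimes> A \<otimes> A\<close>, in which \<open>(A \<otimes> A) \<otimes> A\<close> and \<open>A \<otimes> (A \<otimes> A)\<close> are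
  identified, lives inside the dual of the space of trilinear forms.
\<close>

type_synonym ('k, 'a) tens2 = "('a \<Rightarrow> 'a \<Rightarrow> 'k) \<Rightarrow> 'k"
type_synonym ('k, 'a) tens3 = "('a \<Rightarrow> 'a \<Rightarrow> 'a \<Rightarrow> 'k) \<Rightarrow> 'k"

definition pure2 ::
  "('k::field \<Rightarrow> 'a::ab_group_add \<Rightarrow> 'a) \<Rightarrow> 'a \<Rightarrow> 'a \<Rightarrow> ('k, 'a) tens2" where
  "pure2 s a b = (\<lambda>\<beta>. if bilin s \<beta> then \<beta> a b else 0)"

definition pure3 ::
  "('k::field \<Rightarrow> 'a::ab_group_add \<Rightarrow> 'a) \<Rightarrow> 'a \<Rightarrow> 'a \<Rightarrow> 'a \<Rightarrow> ('k, 'a) tens3" where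
  "pure3 s a b c = (\<lambda>\<gamma>. if trilin s \<gamma> then \<gamma> a b c else 0)"

definition tensor2 :: "('k::field \<Rightarrow> 'a::ab_group_add \<Rightarrow> 'a) \<Rightarrow> ('k, 'a) tens2 set" where
  "tensor2 s = module.span fun_scale {pure2 s a b | a b. True}"

text \<open>The linear map \<open>\<phi> \<otimes> \<psi>\<close>, see \<open>tensor_map_pure2\<close>.\<close>

definition tensor_map ::
  "('k::field \<Rightarrow> 'a::ab_group_add \<Rightarrow> 'a) \<Rightarrow> ('a \<Rightarrow> 'a) \<Rightarrow> ('a \<Rightarrow> 'a) \<Rightarrow>
   ('k, 'a) tens2 \<Rightarrow> ('k, 'a) tens2" where
  "tensor_map s \<phi> \<psi> T = (\<lambda>\<beta>. if bilin s \<beta> then T (\<lambda>x y. \<beta> (\<phi> x) (\<psi> y)) else 0)"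

text \<open>The flip \<open>\<tau>\<close>, see \<open>flip2_pure2\<close>.\<close>

definition flip2 :: "('k, 'a) tens2 \<Rightarrow> ('k, 'a) tens2" where
  "flip2 T = (\<lambda>\<beta>. T (\<lambda>x y. \<beta> y x))"

text \<open>
  The maps \<open>\<Delta> \<otimes> id\<close> and \<open>id \<otimes> \<Delta>\<close> from \<open>A \<otimes> A\<close> to \<open>A \<otimes> A \<otimes> A\<close>.
  On a pure tensor \<open>a \<otimes> b\<close> they give \<open>\<Delta> a \<otimes> b\<close> and \<open>a \<otimes> \<Delta> b\<close>, where
  \<open>T \<otimes> b\<close> evaluates \<open>\<gamma>\<close> by applying \<open>T\<close> to \<open>\<lambda>u v. \<gamma> u v b\<close>.
\<close>

definition tensor_left ::
  "('k::field \<Rightarrow> 'a::ab_group_add \<Rightarrow> 'a) \<Rightarrow> ('a \<Rightarrow> ('k, 'a) tens2) \<Rightarrow>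
   ('k, 'a) tens2 \<Rightarrow> ('k, 'a) tens3" where
  "tensor_left s \<Delta> T = (\<lambda>\<gamma>. if trilin s \<gamma> then T (\<lambda>x y. \<Delta> x (\<lambda>u v. \<gamma> u v y)) else 0)"

definition tensor_right ::
  "('k::field \<Rightarrow> 'a::ab_group_add \<Rightarrow> 'a) \<Rightarrow> ('a \<Rightarrow> ('k, 'a) tens2) \<Rightarrow>
   ('k, 'a) tens2 \<Rightarrow> ('k, 'a) tens3" where
  "tensor_right s \<Delta> T = (\<lambda>\<gamma>. if trilin s \<gamma> then T (\<lambda>x y. \<Delta> y (\<lambda>u v. \<gamma> x u v)) else 0)"

text \<open>The pairing of \<open>f \<otimes> g\<close>, for \<open>f\<close> and \<open>g\<close> in the dual, with a tensor.\<close>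

definition pair2 :: "('a \<Rightarrow> 'k::field) \<Rightarrow> ('a \<Rightarrow> 'k) \<Rightarrow> ('k, 'a) tens2 \<Rightarrow> 'k" where
  "pair2 f g T = T (\<lambda>x y. f x * g y)"

section \<open>Perm algebras\<close>

text \<open>
  Spaces are subspaces of an ambient vector space. Bilinear maps \<open>U \<times> V \<rightarrow> W\<close>
  also serve as linear maps \<open>U \<rightarrow> Hom(V, W)\<close>.
\<close>

definition bilinear_on ::
  "('k \<Rightarrow> 'u \<Rightarrow> 'u) \<Rightarrow> 'u set \<Rightarrow> ('k \<Rightarrow> 'v \<Rightarrow> 'v) \<Rightarrow> 'v set \<Rightarrow> ('k \<Rightarrow> 'w \<Rightarrow> 'w) \<Rightarrow> 'w set \<Rightarrow>
   ('u::ab_group_add \<Rightarrow> 'v::ab_group_add \<Rightarrow> 'w::ab_group_add) \<Rightarrow> bool" where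
  "bilinear_on sU U sV V sW W h \<longleftrightarrow>
     (\<forall>u\<in>U. \<forall>v\<in>V. h u v \<in> W) \<and>
     (\<forall>u\<in>U. \<forall>u'\<in>U. \<forall>v\<in>V. h (u + u') v = h u v + h u' v) \<and>
     (\<forall>u\<in>U. \<forall>v\<in>V. \<forall>v'\<in>V. h u (v + v') = h u v + h u v') \<and>
     (\<forall>c. \<forall>u\<in>U. \<forall>v\<in>V. h (sU c u) v = sW c (h u v) \<and> h u (sV c v) = sW c (h u v))"

definition perm_algebra ::
  "('k::field \<Rightarrow> 'a::ab_group_add \<Rightarrow> 'a) \<Rightarrow> 'a set \<Rightarrow> ('a \<Rightarrow> 'a \<Rightarrow> 'a) \<Rightarrow> bool" where
  "perm_algebra s P m \<longleftrightarrow>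
     vector_space s \<and> module.subspace s P \<and> bilinear_on s P s P s P m \<and>
     (\<forall>x\<in>P. \<forall>y\<in>P. \<forall>z\<in>P. m (m x y) z = m x (m y z) \<and> m x (m y z) = m x (m z y))"

section \<open>Perm bialgebras\<close>

text \<open>The product on the dual defined by \<open>\<Delta>\<^sup>*\<close>.\<close>

definition dual_mult ::
  "('a \<Rightarrow> ('k::field, 'a) tens2) \<Rightarrow> ('a \<Rightarrow> 'k) \<Rightarrow> ('a \<Rightarrow> 'k) \<Rightarrow> ('a \<Rightarrow> 'k)" where
  "dual_mult \<Delta> f g = (\<lambda>a. pair2 f g (\<Delta> a))"

definition comultiplication ::
  "('k::field \<Rightarrow> 'a::ab_group_add \<Rightarrow> 'a) \<Rightarrow> ('a \<Rightarrow> ('k, 'a) tens2) \<Rightarrow> bool" where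
  "comultiplication s \<Delta> \<longleftrightarrow>
     Vector_Spaces.linear s fun_scale \<Delta> \<and> (\<forall>a. \<Delta> a \<in> tensor2 s)"

definition perm_bialgebra ::
  "('k::field \<Rightarrow> 'a::ab_group_add \<Rightarrow> 'a) \<Rightarrow> ('a \<Rightarrow> 'a \<Rightarrow> 'a) \<Rightarrow> ('a \<Rightarrow> ('k, 'a) tens2) \<Rightarrow> bool" where
  "perm_bialgebra s m \<Delta> \<longleftrightarrow>
     perm_algebra s UNIV m \<and> comultiplication s \<Delta> \<and>
     (\<forall>a. tensor_left s \<Delta> (\<Delta> a) = tensor_right s \<Delta> (\<Delta> a) \<and>
          tensor_right s \<Delta> (\<Delta> a) = tensor_right s (\<lambda>x. flip2 (\<Delta> x)) (\<Delta> a)) \<and>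
     (\<forall>a\<^sub>1 a\<^sub>2.
        let l = (\<lambda>x y. m x y); r = (\<lambda>x y. m y x);
            L = (\<lambda>\<phi>. tensor_map s \<phi> id); R = (\<lambda>\<phi>. tensor_map s id \<phi>)
        in \<Delta> (m a\<^sub>1 a\<^sub>2) - flip2 (\<Delta> (m a\<^sub>1 a\<^sub>2)) = \<Delta> (m a\<^sub>2 a\<^sub>1) - flip2 (\<Delta> (m a\<^sub>2 a\<^sub>1)) \<and>
           \<Delta> (m a\<^sub>2 a\<^sub>1) - flip2 (\<Delta> (m a\<^sub>2 a\<^sub>1)) =
             L (r a\<^sub>2) (\<Delta> a\<^sub>1) - flip2 (R (r a\<^sub>2) (\<Delta> a\<^sub>1))
             + R (r a\<^sub>1) (\<Delta> a\<^sub>2) - flip2 (L (r a\<^sub>1) (\<Delta> a\<^sub>2)) \<and>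
           \<Delta> (m a\<^sub>1 a\<^sub>2) =
             L (l a\<^sub>1) (\<Delta> a\<^sub>2) + R (r a\<^sub>2) (\<Delta> a\<^sub>1) - R (l a\<^sub>2) (\<Delta> a\<^sub>1) \<and>
           \<Delta> (m a\<^sub>1 a\<^sub>2) =
             L (l a\<^sub>1) (\<Delta> a\<^sub>2) - flip2 (R (l a\<^sub>1) (\<Delta> a\<^sub>2)) + R (r a\<^sub>2) (\<Delta> a\<^sub>1) \<and>
           \<Delta> (m a\<^sub>1 a\<^sub>2) =
             L (r a\<^sub>2) (\<Delta> a\<^sub>1) + R (r a\<^sub>1) (\<Delta> a\<^sub>2) - R (l a\<^sub>1) (\<Delta> a\<^sub>2)
             - flip2 (L (r a\<^sub>1) (\<Delta> a\<^sub>2)) + flip2 (L (l a\<^sub>1) (\<Delta> a\<^sub>2)))"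

section \<open>Matched pairs\<close>

definition sum_mult ::
  "('a::ab_group_add \<Rightarrow> 'a \<Rightarrow> 'a) \<Rightarrow> ('b::ab_group_add \<Rightarrow> 'b \<Rightarrow> 'b) \<Rightarrow>
   ('a \<Rightarrow> 'b \<Rightarrow> 'b) \<Rightarrow> ('a \<Rightarrow> 'b \<Rightarrow> 'b) \<Rightarrow> ('b \<Rightarrow> 'a \<Rightarrow> 'a) \<Rightarrow> ('b \<Rightarrow> 'a \<Rightarrow> 'a) \<Rightarrow>
   'a \<times> 'b \<Rightarrow> 'a \<times> 'b \<Rightarrow> 'a \<times> 'b" where
  "sum_mult mA mB l\<^sub>1 r\<^sub>1 l\<^sub>2 r\<^sub>2 = (\<lambda>(a\<^sub>1, b\<^sub>1) (a\<^sub>2, b\<^sub>2).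
     (mA a\<^sub>1 a\<^sub>2 + l\<^sub>2 b\<^sub>1 a\<^sub>2 + r\<^sub>2 b\<^sub>2 a\<^sub>1, mB b\<^sub>1 b\<^sub>2 + l\<^sub>1 a\<^sub>1 b\<^sub>2 + r\<^sub>1 a\<^sub>2 b\<^sub>1))"

definition matched_pair ::
  "('k::field \<Rightarrow> 'a::ab_group_add \<Rightarrow> 'a) \<Rightarrow> 'a set \<Rightarrow> ('a \<Rightarrow> 'a \<Rightarrow> 'a) \<Rightarrow>
   ('k \<Rightarrow> 'b::ab_group_add \<Rightarrow> 'b) \<Rightarrow> 'b set \<Rightarrow> ('b \<Rightarrow> 'b \<Rightarrow> 'b) \<Rightarrow>
   ('a \<Rightarrow> 'b \<Rightarrow> 'b) \<Rightarrow> ('a \<Rightarrow> 'b \<Rightarrow> 'b) \<Rightarrow> ('b \<Rightarrow> 'a \<Rightarrow> 'a) \<Rightarrow> ('b \<Rightarrow> 'a \<Rightarrow> 'a) \<Rightarrow> bool" where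
  "matched_pair sA A mA sB B mB l\<^sub>1 r\<^sub>1 l\<^sub>2 r\<^sub>2 \<longleftrightarrow>
     perm_algebra sA A mA \<and> perm_algebra sB B mB \<and>
     bilinear_on sA A sB B sB B l\<^sub>1 \<and> bilinear_on sA A sB B sB B r\<^sub>1 \<and>
     bilinear_on sB B sA A sA A l\<^sub>2 \<and> bilinear_on sB B sA A sA A r\<^sub>2 \<and>
     perm_algebra (module_prod.scale sA sB) (A \<times> B) (sum_mult mA mB l\<^sub>1 r\<^sub>1 l\<^sub>2 r\<^sub>2)"

definition lstar :: "('a \<Rightarrow> 'a \<Rightarrow> 'a) \<Rightarrow> 'a \<Rightarrow> ('a \<Rightarrow> 'k) \<Rightarrow> ('a \<Rightarrow> 'k)" where
  "lstar m x u = (\<lambda>y. u (m x y))"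

definition rstar :: "('a \<Rightarrow> 'a \<Rightarrow> 'a) \<Rightarrow> 'a \<Rightarrow> ('a \<Rightarrow> 'k) \<Rightarrow> ('a \<Rightarrow> 'k)" where
  "rstar m x u = (\<lambda>y. u (m y x))"

text \<open>
  The same maps for the perm algebra \<open>A\<^sup>*\<close> with product \<open>m'\<close>, acting on \<open>A\<close> through its
  identification with the bidual.
\<close>

definition dual_lstar ::
  "('k::field \<Rightarrow> 'a::ab_group_add \<Rightarrow> 'a) \<Rightarrow> (('a \<Rightarrow> 'k) \<Rightarrow> ('a \<Rightarrow> 'k) \<Rightarrow> ('a \<Rightarrow> 'k)) \<Rightarrow>
   ('a \<Rightarrow> 'k) \<Rightarrow> 'a \<Rightarrow> 'a" where
  "dual_lstar s m' f a = of_bidual s (lstar m' f (\<lambda>g. g a))"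

definition dual_rstar ::
  "('k::field \<Rightarrow> 'a::ab_group_add \<Rightarrow> 'a) \<Rightarrow> (('a \<Rightarrow> 'k) \<Rightarrow> ('a \<Rightarrow> 'k) \<Rightarrow> ('a \<Rightarrow> 'k)) \<Rightarrow>
   ('a \<Rightarrow> 'k) \<Rightarrow> 'a \<Rightarrow> 'a" where
  "dual_rstar s m' f a = of_bidual s (rstar m' f (\<lambda>g. g a))"

section \<open>Standard Manin triples\<close>

definition invariant_form ::
  "'a set \<Rightarrow> ('a \<Rightarrow> 'a \<Rightarrow> 'a) \<Rightarrow> ('a \<Rightarrow> 'a \<Rightarrow> 'k::field) \<Rightarrow> bool" where
  "invariant_form P m \<omega> \<longleftrightarrow>
     (\<forall>x\<in>P. \<forall>y\<in>P. \<forall>z\<in>P. \<omega> (m x y) z = \<omega> y (m z x) - \<omega> y (m x z))"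

definition omega_hat :: "'a \<times> ('a \<Rightarrow> 'k::field) \<Rightarrow> 'a \<times> ('a \<Rightarrow> 'k) \<Rightarrow> 'k" where
  "omega_hat = (\<lambda>(a\<^sub>1, b\<^sub>1) (a\<^sub>2, b\<^sub>2). b\<^sub>2 a\<^sub>1 - b\<^sub>1 a\<^sub>2)"

definition standard_manin_triple ::
  "('k::field \<Rightarrow> 'a::ab_group_add \<Rightarrow> 'a) \<Rightarrow> ('a \<Rightarrow> 'a \<Rightarrow> 'a) \<Rightarrow>
   (('a \<Rightarrow> 'k) \<Rightarrow> ('a \<Rightarrow> 'k) \<Rightarrow> ('a \<Rightarrow> 'k)) \<Rightarrow> bool" where
  "standard_manin_triple s m m' \<longleftrightarrow>
     (\<exists>M. perm_algebra (module_prod.scale s fun_scale) (UNIV \<times> dual s) M \<and>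
          (\<forall>a\<^sub>1 a\<^sub>2. M (a\<^sub>1, 0) (a\<^sub>2, 0) = (m a\<^sub>1 a\<^sub>2, 0)) \<and>
          (\<forall>b\<^sub>1\<in>dual s. \<forall>b\<^sub>2\<in>dual s. M (0, b\<^sub>1) (0, b\<^sub>2) = (0, m' b\<^sub>1 b\<^sub>2)) \<and>
          invariant_form (UNIV \<times> dual s) M omega_hat)"

section \<open>The encodings agree with the usual notions\<close>

lemma linear_field_iff:
  fixes s :: "'k::field \<Rightarrow> 'a::ab_group_add \<Rightarrow> 'a"
  assumes "vector_space s"
  shows "Vector_Spaces.linear s (*) f \<longleftrightarrow>
    (\<forall>x y. f (x + y) = f x + f y) \<and> (\<forall>c x. f (s c x) = c * f x)"
proof -
  have "vector_space ((*) :: 'k \<Rightarrow> 'k \<Rightarrow> 'k)"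
    by unfold_locales (auto simp: algebra_simps)
  then show ?thesis
    using assms by (simp add: Vector_Spaces.linear_iff)
qed

lemma vector_space_fun_scale: "vector_space (fun_scale :: 'k::field \<Rightarrow> ('x \<Rightarrow> 'k) \<Rightarrow> 'x \<Rightarrow> 'k)"
  by unfold_locales (auto simp: fun_scale_def algebra_simps fun_eq_iff)

lemma subspace_dual:
  assumes "vector_space s"
  shows "module.subspace fun_scale (dual s)"
proof -
  interpret f: vector_space fun_scale by (rule vector_space_fun_scale)
  show ?thesis
    by (auto simp: f.subspace_def dual_def linear_field_iff[OF assms] fun_scale_def algebra_simps)
qed

lemma tensor_map_pure2:
  assumes "Vector_Spaces.linear s s \<phi>" "Vector_Spaces.linear s s \<psi>"
  shows "tensor_map s \<phi> \<psi> (pure2 s a b) = pure2 s (\<phi> a) (\<psi> b)"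
proof -
  interpret p: Vector_Spaces.linear s s \<phi> by fact
  interpret q: Vector_Spaces.linear s s \<psi> by fact
  have vs: "vector_space s" by unfold_locales
  have "bilin s (\<lambda>x y. \<beta> (\<phi> x) (\<psi> y))" if "bilin s \<beta>" for \<beta>
    using that by (simp add: bilin_def linear_field_iff[OF vs] p.add p.scale q.add q.scale)
  then show ?thesis
    by (auto simp: tensor_map_def pure2_def)
qed

lemma flip2_pure2: "flip2 (pure2 s a b) = pure2 s b a"
  by (auto simp: flip2_def pure2_def bilin_def fun_eq_iff)

lemma pure2_bilinear:
  assumes "vector_space s"
  shows "pure2 s (a + a') b = pure2 s a b + pure2 s a' b"
    and "pure2 s a (b + b') = pure2 s a b + pure2 s a b'"
    and "pure2 s (s c a) b = fun_scale c (pure2 s a b)"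
    and "pure2 s a (s c b) = fun_scale c (pure2 s a b)"
  by (auto simp: pure2_def bilin_def linear_field_iff[OF assms] fun_scale_def fun_eq_iff)

lemma pair2_pure2:
  assumes "vector_space s" "f \<in> dual s" "g \<in> dual s"
  shows "pair2 f g (pure2 s a b) = f a * g b"
proof -
  have "bilin s (\<lambda>x y. f x * g y)"
    using assms by (auto simp: dual_def bilin_def linear_field_iff algebra_simps)
  then show ?thesis by (simp add: pair2_def pure2_def)
qed

lemma bilin_eval_left:
  assumes vs: "vector_space s" and D: "comultiplication s \<Delta>" and g: "trilin s \<gamma>"
  shows "bilin s (\<lambda>x y. \<Delta> x (\<lambda>u v. \<gamma> u v y))" and "bilin s (\<lambda>x y. \<Delta> y (\<lambda>u v. \<gamma> x u v))"
proof -
  interpret f: vector_space "fun_scale :: 'a \<Rightarrow> (('b \<Rightarrow> 'b \<Rightarrow> 'a) \<Rightarrow> 'a) \<Rightarrow> ('b \<Rightarrow> 'b \<Rightarrow> 'a) \<Rightarrow> 'a"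
    by (rule vector_space_fun_scale)
  interpret D: Vector_Spaces.linear s fun_scale \<Delta> using D by (simp add: comultiplication_def)
  note lin = linear_field_iff[OF vs]
  have T: "T (\<lambda>u v. \<alpha> u v + \<beta> u v) = T \<alpha> + T \<beta> \<and> T (\<lambda>u v. c * \<alpha> u v) = c * T \<alpha>"
    if T: "T \<in> tensor2 s" and a: "bilin s \<alpha>" and b: "bilin s \<beta>" for T \<alpha> \<beta> c
  proof -
    have b1: "bilin s (\<lambda>u v. \<alpha> u v + \<beta> u v)" and b2: "bilin s (\<lambda>u v. c * \<alpha> u v)"
      using a b by (auto simp: bilin_def lin algebra_simps)
    show ?thesis using T unfolding tensor2_def
    proof (induct rule: f.span_induct)
      case base
      show ?case
        by (rule f.subspaceI) (auto simp: fun_scale_def algebra_simps)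
    next
      case (step x)
      then show ?case using a b b1 b2 by (auto simp: pure2_def)
    qed
  qed
  have tens: "\<Delta> x \<in> tensor2 s" for x using D by (simp add: comultiplication_def)
  have bl: "bilin s (\<lambda>u v. \<gamma> u v y)" "bilin s (\<lambda>u v. \<gamma> y u v)" for y
    using g by (auto simp: trilin_def bilin_def)
  have g_add: "\<gamma> u v (y + y') = \<gamma> u v y + \<gamma> u v y'" "\<gamma> u v (s c y) = c * \<gamma> u v y"
    "\<gamma> (y + y') u v = \<gamma> y u v + \<gamma> y' u v" "\<gamma> (s c y) u v = c * \<gamma> y u v" for u v y y' c
    using g by (auto simp: trilin_def lin)
  have g_add': "\<gamma> (y + y') = (\<lambda>u v. \<gamma> y u v + \<gamma> y' u v)" "\<gamma> (s c y) = (\<lambda>u v. c * \<gamma> y u v)" for y y' c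
    by (simp_all add: fun_eq_iff g_add)
  show "bilin s (\<lambda>x y. \<Delta> x (\<lambda>u v. \<gamma> u v y))" "bilin s (\<lambda>x y. \<Delta> y (\<lambda>u v. \<gamma> x u v))"
    by (auto simp: bilin_def lin D.add D.scale fun_scale_def g_add g_add' T[OF tens bl(1) bl(1)]
        T[OF tens bl(2) bl(2)])
qed

lemma tensor_left_pure2:
  assumes "vector_space s" "comultiplication s \<Delta>"
  shows "tensor_left s \<Delta> (pure2 s a b) = (\<lambda>\<gamma>. if trilin s \<gamma> then \<Delta> a (\<lambda>u v. \<gamma> u v b) else 0)"
    and "tensor_right s \<Delta> (pure2 s a b) = (\<lambda>\<gamma>. if trilin s \<gamma> then \<Delta> b (\<lambda>u v. \<gamma> a u v) else 0)"
  using bilin_eval_left[OF assms]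
  by (auto simp: tensor_left_def tensor_right_def pure2_def)

lemma pure3_of_pure2:
  "(\<lambda>\<gamma>. if trilin s \<gamma> then pure2 s a b (\<lambda>u v. \<gamma> u v c) else 0) = pure3 s a b c"
  "(\<lambda>\<gamma>. if trilin s \<gamma> then pure2 s b c (\<lambda>u v. \<gamma> a u v) else 0) = pure3 s a b c"
  by (auto simp: pure2_def pure3_def trilin_def bilin_def)

lemma dual_separates:
  fixes s :: "'k::field \<Rightarrow> 'a::ab_group_add \<Rightarrow> 'a"
  assumes "vector_space s" "\<And>f. f \<in> dual s \<Longrightarrow> f x = f y"
  shows "x = y"
proof (rule ccontr)
  assume "x \<noteq> y"
  interpret vector_space s by fact
  have "vector_space ((*) :: 'k \<Rightarrow> 'k \<Rightarrow> 'k)"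
    by unfold_locales (auto simp: algebra_simps)
  then interpret p: vector_space_pair s "(*) :: 'k \<Rightarrow> 'k \<Rightarrow> 'k"
    unfolding vector_space_pair_def using assms by blast
  have "independent {x - y}" using \<open>x \<noteq> y\<close> by (simp add: dependent_single)
  then obtain f where f: "Vector_Spaces.linear s (*) f" "f (x - y) = 1"
    using p.linear_independent_extend[of "{x - y}" "\<lambda>_. 1"] by auto
  have "f x = f y" using assms(2) f by (simp add: dual_def)
  moreover have "f (x - y) = f x - f y" using f p.linear_diff by blast
  ultimately show False using f by simp
qed

theorem tensor2_universal:
  fixes s :: "'k::field \<Rightarrow> 'a::ab_group_add \<Rightarrow> 'a" and t :: "'k \<Rightarrow> 'v::ab_group_add \<Rightarrow> 'v"
  assumes s: "vector_space s" and t: "vector_space t" and h: "bilinear_on s UNIV s UNIV t UNIV h"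
  shows "\<exists>H. Vector_Spaces.linear fun_scale t H \<and> (\<forall>a b. H (pure2 s a b) = h a b) \<and>
    (\<forall>H'. Vector_Spaces.linear fun_scale t H' \<and> (\<forall>a b. H' (pure2 s a b) = h a b) \<longrightarrow>
       (\<forall>T\<in>tensor2 s. H' T = H T))"
proof -
  let ?P = "{pure2 s a b | a b. True}"
  interpret s: vector_space s by fact
  interpret t: vector_space t by fact
  interpret p: vector_space_pair "fun_scale :: 'k \<Rightarrow> ('k, 'a) tens2 \<Rightarrow> ('k, 'a) tens2" t
    unfolding vector_space_pair_def using t vector_space_fun_scale by blast
  obtain B where B: "B \<subseteq> ?P" "p.vs1.independent B" "?P \<subseteq> p.vs1.span B"
    using p.vs1.maximal_independent_subset by blast
  define ab where "ab = (\<lambda>T. SOME ab. T = pure2 s (fst ab) (snd ab))"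
  have ab: "T = pure2 s (fst (ab T)) (snd (ab T))" if "T \<in> ?P" for T
    unfolding ab_def using that by (intro someI_ex[where P = "\<lambda>ab. T = pure2 s (fst ab) (snd ab)"]) auto
  obtain H where H: "Vector_Spaces.linear fun_scale t H"
    "\<And>T. T \<in> B \<Longrightarrow> H T = h (fst (ab T)) (snd (ab T))"
    using p.linear_independent_extend[OF B(2), of "\<lambda>T. h (fst (ab T)) (snd (ab T))"] by blast
  interpret H: Vector_Spaces.linear fun_scale t H by fact
  have "\<phi> (H T) = T (\<lambda>x y. \<phi> (h x y))" if \<phi>: "\<phi> \<in> dual t" and T: "T \<in> p.vs1.span B" for \<phi> T
    using T
  proof (induct rule: p.vs1.span_induct)
    case base
    have \<phi>': "\<phi> (x + y) = \<phi> x + \<phi> y" "\<phi> (t c x) = c * \<phi> x" for c x y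
      using \<phi> by (auto simp: dual_def linear_field_iff[OF t])
    have \<phi>0: "\<phi> 0 = 0" using \<phi>'(2)[of 0 0] by simp
    show ?case
    proof (rule p.vs1.subspaceI; unfold mem_Collect_eq)
      show "\<phi> (H (fun_scale c T)) = fun_scale c T (\<lambda>x y. \<phi> (h x y))"
        if "\<phi> (H T) = T (\<lambda>x y. \<phi> (h x y))" for c T
        using that by (simp add: H.scale \<phi>') (simp add: fun_scale_def)
    qed (simp_all add: H.zero H.add \<phi>' \<phi>0)
  next
    case (step T)
    have "bilin s (\<lambda>x y. \<phi> (h x y))"
      using \<phi> h by (simp add: bilin_def dual_def linear_field_iff[OF t] linear_field_iff[OF s] bilinear_on_def)
    then have "pure2 s a b (\<lambda>x y. \<phi> (h x y)) = \<phi> (h a b)" for a b by (simp add: pure2_def)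
    then have "pure2 s (fst (ab T)) (snd (ab T)) (\<lambda>x y. \<phi> (h x y)) = \<phi> (H T)"
      by (simp add: H(2)[OF step])
    moreover have "T \<in> ?P" using step B(1) by blast
    ultimately show ?case using ab[of T] by simp
  qed
  note phiH = this
  have Hp: "H (pure2 s a b) = h a b" for a b
  proof (rule dual_separates[OF t])
    fix \<phi> assume \<phi>: "\<phi> \<in> dual t"
    have "bilin s (\<lambda>x y. \<phi> (h x y))"
      using \<phi> h by (simp add: bilin_def dual_def linear_field_iff[OF t] linear_field_iff[OF s] bilinear_on_def)
    then show "\<phi> (H (pure2 s a b)) = \<phi> (h a b)"
      using phiH[OF \<phi>, of "pure2 s a b"] B(3) by (auto simp: pure2_def)
  qed
  have "H' T = H T" if H': "Vector_Spaces.linear fun_scale t H'" "\<And>a b. H' (pure2 s a b) = h a b"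
    and T: "T \<in> tensor2 s" for H' T
    by (rule p.linear_eq_on[OF H'(1) H(1) T[unfolded tensor2_def]]) (use H'(2) Hp in auto)
  then show ?thesis using H(1) Hp by blast
qed

lemma of_bidual_eqI:
  assumes "vector_space s" "\<And>f. f \<in> dual s \<Longrightarrow> f a = F f"
  shows "of_bidual s F = a"
  unfolding of_bidual_def
  by (rule the_equality) (use assms dual_separates[OF assms(1)] in auto)

lemma eval_of_bidual:
  fixes s :: "'k::field \<Rightarrow> 'a::ab_group_add \<Rightarrow> 'a"
  assumes "finite_dimensional_vector_space s B"
    and add: "\<And>f g. f \<in> dual s \<Longrightarrow> g \<in> dual s \<Longrightarrow> F (f + g) = F f + F g"
    and scale: "\<And>c f. f \<in> dual s \<Longrightarrow> F (fun_scale c f) = c * F f"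
    and f: "f \<in> dual s"
  shows "f (of_bidual s F) = F f"
proof -
  interpret finite_dimensional_vector_space s B by fact
  have vs: "vector_space s" by unfold_locales
  note lin = linear_field_iff[OF vs]
  define coord where "coord b x = representation B x b" for b x
  have coord: "coord b \<in> dual s" for b
    unfolding dual_def coord_def
    by (simp add: lin representation_add representation_scale independent_Basis span_Basis)
  define a where "a = (\<Sum>b\<in>B. s (F (coord b)) b)"
  interpret fs: vector_space "fun_scale :: 'k \<Rightarrow> ('a \<Rightarrow> 'k) \<Rightarrow> 'a \<Rightarrow> 'k"
    by (rule vector_space_fun_scale)
  have sub: "fs.subspace (dual s)" by (rule subspace_dual[OF vs])
  have zero: "F 0 = 0" using add[OF fs.subspace_0[OF sub] fs.subspace_0[OF sub]] by (metis add_cancel_right_right add_0)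
  have F_sum: "F (\<Sum>b\<in>C. g b) = (\<Sum>b\<in>C. F (g b))" if "finite C" "\<And>b. b \<in> C \<Longrightarrow> g b \<in> dual s"
    for C and g :: "'a \<Rightarrow> 'a \<Rightarrow> 'k"
    using that by (induct C) (auto simp: zero add fs.subspace_sum[OF sub])
  have g_sum: "g (\<Sum>b\<in>C. v b) = (\<Sum>b\<in>C. g (v b))" if "g \<in> dual s" "finite C" for g and C :: "'a set" and v
  proof -
    have g: "g (x + y) = g x + g y" "g (s c x) = c * g x" for x y c
      using that(1) by (simp_all add: dual_def lin)
    have g0: "g 0 = 0" using g(2)[of 0 0] by simp
    show ?thesis using that(2) by (induct C) (simp_all add: g(1) g0)
  qed
  have sum_fun: "(\<Sum>b\<in>C. v b) x = (\<Sum>b\<in>C. v b x)" for C :: "'a set" and v :: "'a \<Rightarrow> 'a \<Rightarrow> 'k" and x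
    by (induct C rule: infinite_finite_induct) auto
  have "g a = F g" if g: "g \<in> dual s" for g
  proof -
    have "g = (\<Sum>b\<in>B. fun_scale (g b) (coord b))"
    proof
      fix x
      have "x = (\<Sum>b\<in>B. s (representation B x b) b)"
        using sum_representation_eq[OF independent_Basis, of x B] finite_Basis span_Basis by auto
      then have "g x = g (\<Sum>b\<in>B. s (representation B x b) b)" by (rule arg_cong)
      also have "\<dots> = (\<Sum>b\<in>B. representation B x b * g b)"
        using g by (simp add: g_sum finite_Basis) (simp add: dual_def lin)
      also have "\<dots> = (\<Sum>b\<in>B. fun_scale (g b) (coord b)) x"
        by (simp add: sum_fun fun_scale_def coord_def mult.commute)
      finally show "g x = (\<Sum>b\<in>B. fun_scale (g b) (coord b)) x" .
    qed
    then have "F g = F (\<Sum>b\<in>B. fun_scale (g b) (coord b))" by (rule arg_cong)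
    also have "\<dots> = (\<Sum>b\<in>B. g b * F (coord b))"
      using coord by (simp add: F_sum finite_Basis fs.subspace_scale[OF sub] scale)
    also have "\<dots> = g a"
      unfolding a_def using g by (simp add: g_sum finite_Basis) (simp add: dual_def lin mult.commute)
    finally show ?thesis by simp
  qed
  then show ?thesis using of_bidual_eqI[OF vs] f by metis
qed

end

theory Submission
  imports Defs
begin

text \<open>
  Write \<open>f \<star> g\<close> for the product on \<open>A*\<close> and \<open>l\<close>, \<open>r\<close> for the maps \<open>lstar m\<close>, \<open>rstar m\<close>. All three
  conditions turn out to be equivalent to one system of scalar identities, \<open>compatible\<close>, in
  \<open>a, b\<close> from \<open>A\<close> and \<open>f, g\<close> from \<open>A*\<close>.

  For the bialgebra: in finite dimension a tensor is determined by its pairings with pure tensors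
  \<open>f \<otimes> g\<close> (\<open>bilin_functional_eqI\<close>). Paired in this way, coassociativity becomes the perm identities
  of \<open>A*\<close>, hence is automatic (\<open>coassociative\<close>), and the remaining axioms become five linear
  relations between scalars \<open>(f \<star> g) (m a b)\<close>, \<open>(l a f \<star> g) b\<close> and the like, which are equivalent
  to the three relations in \<open>compatible\<close> (\<open>perm_bialgebra_iff\<close>).

  For the matched pair: the only nontrivial requirement is that the product on \<open>A \<oplus> A*\<close> is perm. By
  multilinearity this concerns triples with entries in \<open>A\<close> or \<open>A*\<close>. Testing both components of the
  identities against \<open>A*\<close> and \<open>A\<close>, one obtains scalar relations in four arguments. Those with at least three
  arguments of the same kind follow from the perm identities of \<open>A\<close> and of \<open>A*\<close>. Those with two of each kind are again linear
  relations between the scalars above, and they hold exactly under \<open>compatible\<close>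
  (\<open>perm_algebra_double_iff\<close>).

  For the Manin triple: the product of the matched pair leaves the form invariant, and conversely
  invariance determines the mixed products from those of \<open>A\<close> and \<open>A*\<close>, so that no other product is
  possible (\<open>invariant_extension_unique\<close>).
\<close>

section \<open>Tensors are determined by their pairings\<close>

lemma dual_iff:
  assumes "vector_space s"
  shows "f \<in> dual s \<longleftrightarrow> (\<forall>x y. f (x + y) = f x + f y) \<and> (\<forall>c x. f (s c x) = c * f x)"
  by (simp add: dual_def linear_field_iff[OF assms])

lemma bilin_iff_dual: "bilin s \<beta> \<longleftrightarrow> (\<forall>x. (\<lambda>y. \<beta> x y) \<in> dual s) \<and> (\<forall>y. (\<lambda>x. \<beta> x y) \<in> dual s)"
  by (simp add: bilin_def dual_def)

lemma trilin_iff_dual: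
  "trilin s \<gamma> \<longleftrightarrow> (\<forall>y z. (\<lambda>x. \<gamma> x y z) \<in> dual s) \<and> (\<forall>x z. (\<lambda>y. \<gamma> x y z) \<in> dual s) \<and>
     (\<forall>x y. (\<lambda>z. \<gamma> x y z) \<in> dual s)"
  by (simp add: trilin_def dual_def)

text \<open>Coordinate forms \<open>e\<close> with respect to \<open>B\<close>, and the expansion of a linear form along them.\<close>

lemma dual_coordinates:
  assumes "finite_dimensional_vector_space s B"
  obtains e where "finite B" "\<And>b. e b \<in> dual s" "\<And>g x. g \<in> dual s \<Longrightarrow> g x = (\<Sum>b\<in>B. g b * e b x)"
proof
  interpret finite_dimensional_vector_space s B by fact
  have vs: "vector_space s" by unfold_locales
  let ?e = "\<lambda>b x. representation B x b"
  show "finite B" by (rule finite_Basis)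
  show "?e b \<in> dual s" for b
    by (simp add: dual_iff[OF vs] representation_add representation_scale independent_Basis span_Basis)
  show "g x = (\<Sum>b\<in>B. g b * ?e b x)" if g: "g \<in> dual s" for g x
  proof -
    have g': "g (x + y) = g x + g y" "g (s c x) = c * g x" for x y c
      using g by (simp_all add: dual_iff[OF vs])
    have "g 0 = 0" using g'(2)[of 0 0] by simp
    then have g_sum: "g (\<Sum>b\<in>C. v b) = (\<Sum>b\<in>C. g (v b))" for C :: "'b set" and v
      by (induct C rule: infinite_finite_induct) (simp_all add: g')
    have "x = (\<Sum>b\<in>B. s (representation B x b) b)"
      using sum_representation_eq[OF independent_Basis, of x B] finite_Basis span_Basis by auto
    then have "g x = g (\<Sum>b\<in>B. s (representation B x b) b)" by (rule arg_cong)
    then show ?thesis by (simp add: g_sum g' mult.commute)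
  qed
qed

text \<open>
  Linear functionals on the space of bilinear forms, extended by zero to all functions: the space in
  which \<open>A \<otimes> A\<close> is realised. The elements of \<open>tensor2 s\<close> and their images under the flip and under
  tensor products of linear maps all belong to it, so it is a convenient place to compare two tensors.
\<close>

definition bilin_functional ::
  "('k::field \<Rightarrow> 'a::ab_group_add \<Rightarrow> 'a) \<Rightarrow> ('k, 'a) tens2 \<Rightarrow> bool" where
  "bilin_functional s T \<longleftrightarrow>
     (\<forall>\<beta>. \<not> bilin s \<beta> \<longrightarrow> T \<beta> = 0) \<and>
     (\<forall>\<alpha> \<beta>. bilin s \<alpha> \<longrightarrow> bilin s \<beta> \<longrightarrow> T (\<lambda>x y. \<alpha> x y + \<beta> x y) = T \<alpha> + T \<beta>) \<and>
     (\<forall>c \<beta>. bilin s \<beta> \<longrightarrow> T (\<lambda>x y. c * \<beta> x y) = c * T \<beta>)"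

text \<open>The analogous space for \<open>A \<otimes> A \<otimes> A\<close>.\<close>

definition trilin_functional ::
  "('k::field \<Rightarrow> 'a::ab_group_add \<Rightarrow> 'a) \<Rightarrow> ('k, 'a) tens3 \<Rightarrow> bool" where
  "trilin_functional s T \<longleftrightarrow>
     (\<forall>\<gamma>. \<not> trilin s \<gamma> \<longrightarrow> T \<gamma> = 0) \<and>
     (\<forall>\<alpha> \<gamma>. trilin s \<alpha> \<longrightarrow> trilin s \<gamma> \<longrightarrow> T (\<lambda>x y z. \<alpha> x y z + \<gamma> x y z) = T \<alpha> + T \<gamma>) \<and>
     (\<forall>c \<gamma>. trilin s \<gamma> \<longrightarrow> T (\<lambda>x y z. c * \<gamma> x y z) = c * T \<gamma>)"

lemma bilin_functionalD:
  assumes "bilin_functional s T"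
  shows "\<not> bilin s \<beta> \<Longrightarrow> T \<beta> = 0"
    and "bilin s \<alpha> \<Longrightarrow> bilin s \<beta> \<Longrightarrow> T (\<lambda>x y. \<alpha> x y + \<beta> x y) = T \<alpha> + T \<beta>"
    and "bilin s \<beta> \<Longrightarrow> T (\<lambda>x y. c * \<beta> x y) = c * T \<beta>"
  using assms unfolding bilin_functional_def by blast+

lemma bilin_combine:
  assumes "vector_space s"
  shows "bilin s \<alpha> \<Longrightarrow> bilin s \<beta> \<Longrightarrow> bilin s (\<lambda>x y. \<alpha> x y + \<beta> x y)"
    and "bilin s \<beta> \<Longrightarrow> bilin s (\<lambda>x y. c * \<beta> x y)"
    and "bilin s (\<lambda>x y. 0)"
    and "f \<in> dual s \<Longrightarrow> g \<in> dual s \<Longrightarrow> bilin s (\<lambda>x y. f x * g y)"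
  by (auto simp: bilin_iff_dual dual_iff[OF assms] algebra_simps)

lemma trilin_combine:
  assumes "vector_space s"
  shows "trilin s \<alpha> \<Longrightarrow> trilin s \<gamma> \<Longrightarrow> trilin s (\<lambda>x y z. \<alpha> x y z + \<gamma> x y z)"
    and "trilin s \<gamma> \<Longrightarrow> trilin s (\<lambda>x y z. c * \<gamma> x y z)"
    and "trilin s (\<lambda>x y z. 0)"
    and "f \<in> dual s \<Longrightarrow> g \<in> dual s \<Longrightarrow> h \<in> dual s \<Longrightarrow> trilin s (\<lambda>x y z. f x * g y * h z)"
  by (auto simp: trilin_iff_dual dual_iff[OF assms] algebra_simps)

lemma bilin_functional_sum:
  assumes vs: "vector_space s" and T: "bilin_functional s T"
    and "finite C" "\<And>i. i \<in> C \<Longrightarrow> bilin s (\<beta> i)"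
  shows "bilin s (\<lambda>x y. \<Sum>i\<in>C. c i * \<beta> i x y) \<and>
    T (\<lambda>x y. \<Sum>i\<in>C. c i * \<beta> i x y) = (\<Sum>i\<in>C. c i * T (\<beta> i))"
  using assms(3,4)
proof (induct C)
  case empty
  have "T (\<lambda>x y. 0 * 0) = 0 * T (\<lambda>x y. 0)"
    using T bilin_combine(3)[OF vs] unfolding bilin_functional_def by blast
  then show ?case by (simp add: bilin_combine(3)[OF vs])
next
  case (insert i C)
  let ?S = "\<lambda>x y. \<Sum>i\<in>C. c i * \<beta> i x y"
  have IH: "bilin s ?S" "T ?S = (\<Sum>i\<in>C. c i * T (\<beta> i))" and i: "bilin s (\<beta> i)"
    using insert by auto
  note ci = bilin_combine(2)[OF vs i, of "c i"]
  have "T (\<lambda>x y. c i * \<beta> i x y) = c i * T (\<beta> i)"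
    using T i by (simp add: bilin_functional_def)
  moreover have "T (\<lambda>x y. c i * \<beta> i x y + ?S x y) = T (\<lambda>x y. c i * \<beta> i x y) + T ?S"
    using T ci IH(1) by (simp add: bilin_functional_def)
  ultimately show ?case
    using insert(1,2) IH(2) bilin_combine(1)[OF vs ci IH(1)] by simp
qed

lemma trilin_functional_sum:
  assumes vs: "vector_space s" and T: "trilin_functional s T"
    and "finite C" "\<And>i. i \<in> C \<Longrightarrow> trilin s (\<gamma> i)"
  shows "trilin s (\<lambda>x y z. \<Sum>i\<in>C. c i * \<gamma> i x y z) \<and>
    T (\<lambda>x y z. \<Sum>i\<in>C. c i * \<gamma> i x y z) = (\<Sum>i\<in>C. c i * T (\<gamma> i))"
  using assms(3,4)
proof (induct C)
  case empty
  have "T (\<lambda>x y z. 0 * 0) = 0 * T (\<lambda>x y z. 0)"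
    using T trilin_combine(3)[OF vs] unfolding trilin_functional_def by blast
  then show ?case by (simp add: trilin_combine(3)[OF vs])
next
  case (insert i C)
  let ?S = "\<lambda>x y z. \<Sum>i\<in>C. c i * \<gamma> i x y z"
  have IH: "trilin s ?S" "T ?S = (\<Sum>i\<in>C. c i * T (\<gamma> i))" and i: "trilin s (\<gamma> i)"
    using insert by auto
  note ci = trilin_combine(2)[OF vs i, of "c i"]
  have "T (\<lambda>x y z. c i * \<gamma> i x y z) = c i * T (\<gamma> i)"
    using T i by (simp add: trilin_functional_def)
  moreover have "T (\<lambda>x y z. c i * \<gamma> i x y z + ?S x y z) = T (\<lambda>x y z. c i * \<gamma> i x y z) + T ?S"
    using T ci IH(1) by (simp add: trilin_functional_def)
  ultimately show ?case
    using insert(1,2) IH(2) trilin_combine(1)[OF vs ci IH(1)] by simp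
qed

text \<open>
  In finite dimension the products of two linear forms span the bilinear forms, so a tensor is
  determined by its pairings with pure tensors of the dual. The same holds for three factors.
\<close>

lemma bilin_functional_eqI:
  assumes fd: "finite_dimensional_vector_space s B"
    and S: "bilin_functional s S" and T: "bilin_functional s T"
    and eq: "\<And>f g. f \<in> dual s \<Longrightarrow> g \<in> dual s \<Longrightarrow> pair2 f g S = pair2 f g T"
  shows "S = T"
proof
  fix \<beta>
  interpret finite_dimensional_vector_space s B by fact
  have vs: "vector_space s" by unfold_locales
  obtain e where e: "finite B" "\<And>b. e b \<in> dual s"
    "\<And>g x. g \<in> dual s \<Longrightarrow> g x = (\<Sum>b\<in>B. g b * e b x)"
    using dual_coordinates[OF fd] by metis
  show "S \<beta> = T \<beta>"
  proof (cases "bilin s \<beta>")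
    case False
    then show ?thesis using S T by (simp add: bilin_functional_def)
  next
    case True
    let ?C = "B \<times> B"
    have expand: "\<beta> x y = (\<Sum>i\<in>B. \<beta> i y * e i x)" "\<beta> x y = (\<Sum>j\<in>B. \<beta> x j * e j y)" for x y
      using True by (auto simp only: bilin_iff_dual intro!: e(3))
    have "\<beta> x y = (\<Sum>i\<in>?C. \<beta> (fst i) (snd i) * (e (fst i) x * e (snd i) y))" for x y
    proof -
      have "\<beta> x y = (\<Sum>i\<in>B. \<beta> i y * e i x)" by (rule expand)
      also have "\<dots> = (\<Sum>i\<in>B. (\<Sum>j\<in>B. \<beta> i j * e j y) * e i x)"
        by (intro sum.cong refl arg_cong2[where f = "(*)"]) (rule expand)
      finally show ?thesis
        by (simp add: sum.cartesian_product' sum_distrib_left mult_ac)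
    qed
    then have \<beta>: "\<beta> = (\<lambda>x y. \<Sum>i\<in>?C. \<beta> (fst i) (snd i) * (e (fst i) x * e (snd i) y))"
      by (intro ext)
    have U: "U \<beta> = (\<Sum>i\<in>?C. \<beta> (fst i) (snd i) * pair2 (e (fst i)) (e (snd i)) U)"
      if "bilin_functional s U" for U
      by (subst \<beta>, unfold pair2_def, rule bilin_functional_sum[OF vs that, THEN conjunct2])
        (use e(1,2) in \<open>auto intro: bilin_combine(4)[OF vs]\<close>)
    show ?thesis unfolding U[OF S] U[OF T] by (simp only: eq e(2))
  qed
qed

lemma trilin_functional_eqI:
  assumes fd: "finite_dimensional_vector_space s B"
    and S: "trilin_functional s S" and T: "trilin_functional s T"
    and eq: "\<And>f g h. f \<in> dual s \<Longrightarrow> g \<in> dual s \<Longrightarrow> h \<in> dual s \<Longrightarrow>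
      S (\<lambda>x y z. f x * g y * h z) = T (\<lambda>x y z. f x * g y * h z)"
  shows "S = T"
proof
  fix \<gamma>
  interpret finite_dimensional_vector_space s B by fact
  have vs: "vector_space s" by unfold_locales
  obtain e where e: "finite B" "\<And>b. e b \<in> dual s"
    "\<And>g x. g \<in> dual s \<Longrightarrow> g x = (\<Sum>b\<in>B. g b * e b x)"
    using dual_coordinates[OF fd] by metis
  show "S \<gamma> = T \<gamma>"
  proof (cases "trilin s \<gamma>")
    case False
    then show ?thesis using S T by (simp add: trilin_functional_def)
  next
    case True
    let ?C = "B \<times> B \<times> B"
    let ?c = "\<lambda>i. \<gamma> (fst i) (fst (snd i)) (snd (snd i))"
    let ?e = "\<lambda>i x y z. e (fst i) x * e (fst (snd i)) y * e (snd (snd i)) z"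
    have expand: "\<gamma> x y z = (\<Sum>i\<in>B. \<gamma> i y z * e i x)" "\<gamma> x y z = (\<Sum>j\<in>B. \<gamma> x j z * e j y)"
      "\<gamma> x y z = (\<Sum>k\<in>B. \<gamma> x y k * e k z)" for x y z
      using True by (auto simp only: trilin_iff_dual intro!: e(3))
    have "\<gamma> x y z = (\<Sum>i\<in>?C. ?c i * ?e i x y z)" for x y z
    proof -
      have "\<gamma> x y z = (\<Sum>i\<in>B. \<gamma> i y z * e i x)" by (rule expand)
      also have "\<dots> = (\<Sum>i\<in>B. (\<Sum>j\<in>B. \<gamma> i j z * e j y) * e i x)"
        by (intro sum.cong refl arg_cong2[where f = "(*)"]) (rule expand)
      also have "\<dots> = (\<Sum>i\<in>B. (\<Sum>j\<in>B. (\<Sum>k\<in>B. \<gamma> i j k * e k z) * e j y) * e i x)"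
        by (intro sum.cong refl arg_cong2[where f = "(*)"]) (rule expand)
      finally show ?thesis
        by (simp add: sum.cartesian_product' sum_distrib_left mult_ac)
    qed
    then have \<gamma>: "\<gamma> = (\<lambda>x y z. \<Sum>i\<in>?C. ?c i * ?e i x y z)"
      by (intro ext)
    have U: "U \<gamma> = (\<Sum>i\<in>?C. ?c i * U (?e i))" if "trilin_functional s U" for U
      by (subst \<gamma>, rule trilin_functional_sum[OF vs that, THEN conjunct2])
        (use e(1,2) in \<open>auto intro: trilin_combine(4)[OF vs]\<close>)
    show ?thesis unfolding U[OF S] U[OF T] by (simp only: eq e(2))
  qed
qed

lemma bilin_functional_tensor2:
  assumes vs: "vector_space s" and T: "T \<in> tensor2 s"
  shows "bilin_functional s T"
proof -
  interpret f: vector_space "fun_scale :: 'a \<Rightarrow> ('a, 'b) tens2 \<Rightarrow> ('a, 'b) tens2"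
    by (rule vector_space_fun_scale)
  show ?thesis using T unfolding tensor2_def
  proof (induct rule: f.span_induct)
    case base
    show ?case
      by (rule f.subspaceI) (auto simp: bilin_functional_def fun_scale_def algebra_simps)
  next
    case (step x)
    then show ?case
      by (auto simp: bilin_functional_def pure2_def bilin_combine[OF vs])
  qed
qed

lemma bilin_functional_closed:
  assumes vs: "vector_space s"
  shows "bilin_functional s S \<Longrightarrow> bilin_functional s T \<Longrightarrow> bilin_functional s (S + T)"
    and "bilin_functional s S \<Longrightarrow> bilin_functional s T \<Longrightarrow> bilin_functional s (S - T)"
    and "bilin_functional s S \<Longrightarrow> bilin_functional s (flip2 S)"
    and "bilin_functional s S \<Longrightarrow> Vector_Spaces.linear s s \<phi> \<Longrightarrow> Vector_Spaces.linear s s \<psi> \<Longrightarrow>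
      bilin_functional s (tensor_map s \<phi> \<psi> S)"
proof -
  show "bilin_functional s (S + T)" "bilin_functional s (S - T)"
    if "bilin_functional s S" "bilin_functional s T"
    unfolding bilin_functional_def
    by (simp_all add: bilin_functionalD[OF that(1)] bilin_functionalD[OF that(2)] right_diff_distrib
        distrib_left)
  show "bilin_functional s (flip2 S)" if "bilin_functional s S"
    unfolding bilin_functional_def flip2_def
  proof (intro conjI allI impI)
    fix \<alpha> \<beta> :: "'b \<Rightarrow> 'b \<Rightarrow> 'a" and c
    show "S (\<lambda>x y. \<beta> y x) = 0" if "\<not> bilin s \<beta>"
      using that by (intro bilin_functionalD(1)[OF \<open>bilin_functional s S\<close>]) (auto simp: bilin_def)
    show "S (\<lambda>x y. \<alpha> y x + \<beta> y x) = S (\<lambda>x y. \<alpha> y x) + S (\<lambda>x y. \<beta> y x)"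
      if "bilin s \<alpha>" "bilin s \<beta>"
      using that by (intro bilin_functionalD(2)[OF \<open>bilin_functional s S\<close>]) (auto simp: bilin_def)
    show "S (\<lambda>x y. c * \<beta> y x) = c * S (\<lambda>x y. \<beta> y x)" if "bilin s \<beta>"
      using that by (intro bilin_functionalD(3)[OF \<open>bilin_functional s S\<close>]) (auto simp: bilin_def)
  qed
  show "bilin_functional s (tensor_map s \<phi> \<psi> S)"
    if "bilin_functional s S" "Vector_Spaces.linear s s \<phi>" "Vector_Spaces.linear s s \<psi>"
  proof -
    have "bilin s (\<lambda>x y. \<beta> (\<phi> x) (\<psi> y))" if "bilin s \<beta>" for \<beta>
      using that \<open>Vector_Spaces.linear s s \<phi>\<close> \<open>Vector_Spaces.linear s s \<psi>\<close>
      by (simp add: bilin_def linear_field_iff[OF vs] Vector_Spaces.linear_iff)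
    then show ?thesis
      unfolding bilin_functional_def tensor_map_def
      by (simp add: bilin_functionalD[OF that(1)] bilin_combine[OF vs])
  qed
qed

lemma trilin_functional_tensor_left_right:
  assumes vs: "vector_space s" and D: "comultiplication s \<Delta>" and T: "T \<in> tensor2 s"
  shows "trilin_functional s (tensor_left s \<Delta> T)" "trilin_functional s (tensor_right s \<Delta> T)"
proof -
  have T: "bilin_functional s T" by (rule bilin_functional_tensor2[OF vs T])
  have D': "bilin_functional s (\<Delta> x)" for x
    using D by (simp add: comultiplication_def bilin_functional_tensor2[OF vs])
  note add = bilin_functionalD(2) and scale = bilin_functionalD(3)
  have slice: "bilin s (\<lambda>u v. \<gamma> u v y)" "bilin s (\<lambda>u v. \<gamma> y u v)" if "trilin s \<gamma>" for \<gamma> y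
    using that by (auto simp: trilin_def bilin_def)
  note eval = bilin_eval_left[OF vs D]
  show "trilin_functional s (tensor_left s \<Delta> T)"
    unfolding trilin_functional_def tensor_left_def
    by (simp add: trilin_combine[OF vs] add[OF D' slice(1) slice(1)] scale[OF D' slice(1)]
        add[OF T eval(1) eval(1)] scale[OF T eval(1)])
  show "trilin_functional s (tensor_right s \<Delta> T)"
    unfolding trilin_functional_def tensor_right_def
    by (simp add: trilin_combine[OF vs] add[OF D' slice(2) slice(2)] scale[OF D' slice(2)]
        add[OF T eval(2) eval(2)] scale[OF T eval(2)])
qed

section \<open>Triples satisfying the perm identities\<close>

text \<open>
  The perm identities for one triple. For a bilinear product both are additive in every argument, so
  on a direct sum it is enough to check triples whose entries each lie in one of the summands.
\<close>

definition perm_triple :: "('v \<Rightarrow> 'v \<Rightarrow> 'v) \<Rightarrow> 'v \<Rightarrow> 'v \<Rightarrow> 'v \<Rightarrow> bool" where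
  "perm_triple M x y z \<longleftrightarrow> M (M x y) z = M x (M y z) \<and> M x (M y z) = M x (M z y)"

lemma perm_triple_add:
  assumes "bilinear_on t P t P t P M" "x \<in> P" "x' \<in> P" "y \<in> P" "z \<in> P"
  shows "perm_triple M x y z \<Longrightarrow> perm_triple M x' y z \<Longrightarrow> perm_triple M (x + x') y z"
    and "perm_triple M y x z \<Longrightarrow> perm_triple M y x' z \<Longrightarrow> perm_triple M y (x + x') z"
    and "perm_triple M y z x \<Longrightarrow> perm_triple M y z x' \<Longrightarrow> perm_triple M y z (x + x')"
  using assms by (simp_all add: perm_triple_def bilinear_on_def)

section \<open>A perm algebra with a perm product on its dual\<close>

text \<open>
  A finite-dimensional perm algebra \<open>A\<close> with a comultiplication whose transpose is a perm product
  on \<open>A*\<close>. Here \<open>l\<close>, \<open>r\<close> are the actions of \<open>A\<close> on \<open>A*\<close> dual to its left and right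
  multiplications, and \<open>L\<close>, \<open>R\<close> those of \<open>A*\<close> on \<open>A\<close>.
\<close>

locale perm_dual_pair =
  fixes s :: "'k::field \<Rightarrow> 'a::ab_group_add \<Rightarrow> 'a"
    and B :: "'a set"
    and m :: "'a \<Rightarrow> 'a \<Rightarrow> 'a"
    and \<Delta> :: "'a \<Rightarrow> ('k, 'a) tens2"
  assumes fd: "finite_dimensional_vector_space s B"
    and perm_m: "perm_algebra s UNIV m"
    and comult: "comultiplication s \<Delta>"
    and perm_star: "perm_algebra fun_scale (dual s) (dual_mult \<Delta>)"
begin

abbreviation star (infixl "\<star>" 70) where "f \<star> g \<equiv> dual_mult \<Delta> f g"
abbreviation "l \<equiv> lstar m"
abbreviation "r \<equiv> rstar m"
abbreviation "L \<equiv> dual_lstar s (dual_mult \<Delta>)"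
abbreviation "R \<equiv> dual_rstar s (dual_mult \<Delta>)"

lemma vs: "vector_space s"
  using perm_m by (simp add: perm_algebra_def)

sublocale f: vector_space "fun_scale :: 'k \<Rightarrow> ('a \<Rightarrow> 'k) \<Rightarrow> 'a \<Rightarrow> 'k"
  by (rule vector_space_fun_scale)

sublocale vector_space_prod s "fun_scale :: 'k \<Rightarrow> ('a \<Rightarrow> 'k) \<Rightarrow> 'a \<Rightarrow> 'k"
  unfolding vector_space_prod_def vector_space_pair_def using vs f.vector_space_axioms by blast

lemma dual_apply:
  assumes "f \<in> dual s"
  shows "f (x + y) = f x + f y" and "f (x - y) = f x - f y" and "f (s c x) = c * f x" and "f 0 = 0"
proof -
  show add: "f (x + y) = f x + f y" and scale: "f (s c x) = c * f x" for x y c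
    using assms by (simp_all add: dual_iff[OF vs])
  show diff: "f (x - y) = f x - f y" for x y using add[of "x - y" y] by simp
  show "f 0 = 0" using diff[of 0 0] by simp
qed

lemma m_bilinear:
  "m (x + y) z = m x z + m y z" "m x (y + z) = m x y + m x z"
  "m (s c x) z = s c (m x z)" "m x (s c z) = s c (m x z)"
  using perm_m by (simp_all add: perm_algebra_def bilinear_on_def)

lemma m_diff_zero:
  "m (x - y) z = m x z - m y z" "m x (y - z) = m x y - m x z" "m 0 z = 0" "m x 0 = 0"
  using m_bilinear(1)[of "x - y" y z] m_bilinear(2)[of x "y - z" z]
    m_bilinear(1)[of 0 0 z] m_bilinear(2)[of x 0 0] by simp_all

lemma m_perm: "m x (m y z) = m (m x y) z" "m (m x y) z = m (m x z) y"
  using perm_m unfolding perm_algebra_def by (metis UNIV_I)+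

lemma dual_closed [simp]:
  "f \<in> dual s \<Longrightarrow> g \<in> dual s \<Longrightarrow> f \<star> g \<in> dual s"
  "f \<in> dual s \<Longrightarrow> g \<in> dual s \<Longrightarrow> f + g \<in> dual s"
  "f \<in> dual s \<Longrightarrow> g \<in> dual s \<Longrightarrow> f - g \<in> dual s"
  "f \<in> dual s \<Longrightarrow> fun_scale c f \<in> dual s"
  "0 \<in> dual s"
  "f \<in> dual s \<Longrightarrow> l a f \<in> dual s"
  "f \<in> dual s \<Longrightarrow> r a f \<in> dual s"
proof -
  have sub: "f.subspace (dual s)" by (rule subspace_dual[OF vs])
  show "f \<in> dual s \<Longrightarrow> g \<in> dual s \<Longrightarrow> f + g \<in> dual s"
    "f \<in> dual s \<Longrightarrow> g \<in> dual s \<Longrightarrow> f - g \<in> dual s"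
    "f \<in> dual s \<Longrightarrow> fun_scale c f \<in> dual s" "0 \<in> dual s"
    using f.subspace_add[OF sub] f.subspace_diff[OF sub] f.subspace_scale[OF sub] f.subspace_0[OF sub]
    by blast+
  show "f \<in> dual s \<Longrightarrow> g \<in> dual s \<Longrightarrow> f \<star> g \<in> dual s"
    using perm_star by (simp add: perm_algebra_def bilinear_on_def)
  show "f \<in> dual s \<Longrightarrow> l a f \<in> dual s" "f \<in> dual s \<Longrightarrow> r a f \<in> dual s"
    by (simp_all add: dual_iff[OF vs] lstar_def rstar_def m_bilinear)
qed

lemma star_bilinear:
  assumes "f \<in> dual s" "g \<in> dual s" "h \<in> dual s"
  shows "(f + g) \<star> h = f \<star> h + g \<star> h" "h \<star> (f + g) = h \<star> f + h \<star> g"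
    "fun_scale c f \<star> h = fun_scale c (f \<star> h)" "h \<star> fun_scale c f = fun_scale c (h \<star> f)"
  using perm_star assms by (simp_all add: perm_algebra_def bilinear_on_def)

lemma star_diff:
  assumes "f \<in> dual s" "g \<in> dual s" "h \<in> dual s"
  shows "(f - g) \<star> h = f \<star> h - g \<star> h" "h \<star> (f - g) = h \<star> f - h \<star> g"
  using star_bilinear(1)[of "f - g" g h] star_bilinear(2)[of "f - g" g h] assms
  by (simp_all add: eq_diff_eq)

lemma star_zero:
  assumes "f \<in> dual s"
  shows "0 \<star> f = 0" "f \<star> 0 = 0"
  using star_diff[of f f f] star_diff[of 0 0 f] assms by simp_all

lemma star_perm:
  assumes "f \<in> dual s" "g \<in> dual s" "h \<in> dual s"
  shows "f \<star> (g \<star> h) = f \<star> g \<star> h" "f \<star> g \<star> h = f \<star> h \<star> g"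
  using perm_star assms unfolding perm_algebra_def by metis+

lemma lstar_rstar_apply: "l a f b = f (m a b)" "r a f b = f (m b a)"
  by (simp_all add: lstar_def rstar_def)

text \<open>
  The actions of \<open>A*\<close> on \<open>A\<close>, which are defined through the bidual, turn into products in \<open>A*\<close>
  as soon as a linear form is applied. Here the dimension has to be finite.
\<close>

lemma eval_L_R:
  assumes "f \<in> dual s" "g \<in> dual s"
  shows "g (R f a) = (g \<star> f) a" "g (L f a) = (f \<star> g) a"
  unfolding dual_rstar_def dual_lstar_def using assms
  by (simp_all add: eval_of_bidual[OF fd] lstar_def rstar_def star_bilinear fun_scale_def[of _ "_ \<star> _"])

lemma eq_iff_dual: "x = y \<longleftrightarrow> (\<forall>g\<in>dual s. g x = g y)"
  using dual_separates[OF vs] by blast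

section \<open>Pairing the bialgebra axioms with the dual\<close>

lemma Delta_functional: "bilin_functional s (\<Delta> a)"
  using comult by (simp add: comultiplication_def bilin_functional_tensor2[OF vs])

lemma pair2_simps:
  "pair2 f g (S + T) = pair2 f g S + pair2 f g T"
  "pair2 f g (S - T) = pair2 f g S - pair2 f g T"
  "pair2 f g (flip2 S) = pair2 g f S"
  "pair2 f g (\<Delta> a) = (f \<star> g) a"
  by (simp_all add: pair2_def flip2_def dual_mult_def mult.commute)

lemma pair2_tensor_map:
  assumes "f \<in> dual s" "g \<in> dual s"
  shows "pair2 f g (tensor_map s \<phi> \<psi> S) = pair2 (\<lambda>x. f (\<phi> x)) (\<lambda>x. g (\<psi> x)) S"
  using bilin_combine(4)[OF vs assms] by (simp add: pair2_def tensor_map_def)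

lemma linear_m: "Vector_Spaces.linear s s (\<lambda>y. m a y)" "Vector_Spaces.linear s s (\<lambda>y. m y a)"
  using vs by (simp_all add: Vector_Spaces.linear_iff m_bilinear)

lemma linear_id: "Vector_Spaces.linear s s id"
  using vs by (simp add: Vector_Spaces.linear_iff)

lemma tensor_eq_iff:
  assumes "bilin_functional s S" "bilin_functional s T"
  shows "S = T \<longleftrightarrow> (\<forall>f\<in>dual s. \<forall>g\<in>dual s. pair2 f g S = pair2 f g T)"
  using bilin_functional_eqI[OF fd assms] by blast

text \<open>
  The coalgebra axioms of a perm bialgebra hold in the locale: paired with \<open>f \<otimes> g \<otimes> h\<close>, they are
  the perm identities of the product on the dual.
\<close>

lemma coassociative:
  shows "tensor_left s \<Delta> (\<Delta> a) = tensor_right s \<Delta> (\<Delta> a)"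
    and "tensor_right s \<Delta> (\<Delta> a) = tensor_right s (\<lambda>x. flip2 (\<Delta> x)) (\<Delta> a)"
proof -
  let ?l = "tensor_left s \<Delta> (\<Delta> a)" and ?r = "tensor_right s \<Delta> (\<Delta> a)"
  have "\<Delta> a \<in> tensor2 s" using comult by (simp add: comultiplication_def)
  note lr = trilin_functional_tensor_left_right[OF vs comult this]
  have swap: "trilin s (\<lambda>u v w. \<gamma> u w v) \<longleftrightarrow> trilin s \<gamma>" for \<gamma>
    unfolding trilin_def by blast
  have flip: "tensor_right s (\<lambda>x. flip2 (\<Delta> x)) (\<Delta> a) = (\<lambda>\<gamma>. ?r (\<lambda>u v w. \<gamma> u w v))"
  proof
    fix \<gamma> :: "'a \<Rightarrow> 'a \<Rightarrow> 'a \<Rightarrow> 'k"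
    show "tensor_right s (\<lambda>x. flip2 (\<Delta> x)) (\<Delta> a) \<gamma> = ?r (\<lambda>u v w. \<gamma> u w v)"
      using swap[of \<gamma>] by (simp only: tensor_right_def flip2_def)
  qed
  have lr_flip: "trilin_functional s (\<lambda>\<gamma>. ?r (\<lambda>u v w. \<gamma> u w v))"
    unfolding trilin_functional_def
  proof (intro conjI allI impI)
    fix \<alpha> \<gamma> :: "'a \<Rightarrow> 'a \<Rightarrow> 'a \<Rightarrow> 'k" and c
    note r = lr(2)[unfolded trilin_functional_def]
    show "?r (\<lambda>u v w. \<gamma> u w v) = 0" if "\<not> trilin s \<gamma>"
      using that swap[of \<gamma>] r by blast
    show "?r (\<lambda>u v w. \<alpha> u w v + \<gamma> u w v) = ?r (\<lambda>u v w. \<alpha> u w v) + ?r (\<lambda>u v w. \<gamma> u w v)"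
      if "trilin s \<alpha>" "trilin s \<gamma>"
      using that swap[of \<alpha>] swap[of \<gamma>] r by blast
    show "?r (\<lambda>u v w. c * \<gamma> u w v) = c * ?r (\<lambda>u v w. \<gamma> u w v)" if "trilin s \<gamma>"
      using that swap[of \<gamma>] r by blast
  qed
  have left: "?l (\<lambda>x y z. f x * g y * h z) = (f \<star> g \<star> h) a"
    and right: "?r (\<lambda>x y z. f x * g y * h z) = (f \<star> (g \<star> h)) a"
    if fgh: "f \<in> dual s" "g \<in> dual s" "h \<in> dual s" for f g h
  proof -
    note scale = bilin_functionalD(3)[OF Delta_functional bilin_combine(4)[OF vs]]
    have "\<Delta> x (\<lambda>u v. f u * g v * h y) = (f \<star> g) x * h y"
      and "\<Delta> y (\<lambda>u v. f x * g u * h v) = f x * (g \<star> h) y" for x y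
      using scale[OF fgh(1,2), of x "h y"] scale[OF fgh(2,3), of y "f x"]
      by (simp_all add: dual_mult_def pair2_def mult_ac)
    then show "?l (\<lambda>x y z. f x * g y * h z) = (f \<star> g \<star> h) a"
      "?r (\<lambda>x y z. f x * g y * h z) = (f \<star> (g \<star> h)) a"
      by (simp_all add: tensor_left_def tensor_right_def trilin_combine(4)[OF vs fgh]
          dual_mult_def[of \<Delta> "f \<star> g" h] dual_mult_def[of \<Delta> f "g \<star> h"] pair2_def)
  qed
  show "?l = ?r"
    by (rule trilin_functional_eqI[OF fd lr]) (simp add: left right star_perm)
  have "?r = (\<lambda>\<gamma>. ?r (\<lambda>u v w. \<gamma> u w v))"
  proof (rule trilin_functional_eqI[OF fd lr(2) lr_flip])
    fix f g h assume fgh: "f \<in> dual s" "g \<in> dual s" "h \<in> dual s"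
    have "?r (\<lambda>u v w. f u * g w * h v) = ?r (\<lambda>u v w. f u * h v * g w)"
      by (simp add: mult_ac)
    then show "?r (\<lambda>x y z. f x * g y * h z) = ?r (\<lambda>u v w. f u * g w * h v)"
      using fgh by (simp add: right star_perm)
  qed
  then show "?r = tensor_right s (\<lambda>x. flip2 (\<Delta> x)) (\<Delta> a)"
    by (simp only: flip)
qed

section \<open>Compatibility of the two products\<close>

text \<open>
  Three scalar identities linking the products of \<open>A\<close> and \<open>A*\<close>, to which both the bialgebra axioms
  and the mixed perm identities on \<open>A \<oplus> A*\<close> reduce: a symmetry of the left actions, a derivation
  rule for the commutator \<open>f \<star> g - g \<star> f\<close>, and a formula for \<open>f \<star> g\<close> on a product.
\<close>

definition compatible :: bool where
  "compatible \<longleftrightarrow> (\<forall>f\<in>dual s. \<forall>g\<in>dual s. \<forall>a b.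
     (f \<star> l a g) b = (g \<star> l b f) a \<and>
     (f \<star> g) (m a b) - (g \<star> f) (m a b) =
       (r a f \<star> g) b - (g \<star> r a f) b + (f \<star> r b g) a - (r b g \<star> f) a \<and>
     (f \<star> g) (m a b) = (l a f \<star> g) b + (f \<star> r b g) a - (f \<star> l b g) a)"

lemma compatibleD:
  assumes compatible "f \<in> dual s" "g \<in> dual s"
  shows "(f \<star> l a g) b = (g \<star> l b f) a"
    and "(f \<star> g) (m a b) - (g \<star> f) (m a b) =
       (r a f \<star> g) b - (g \<star> r a f) b + (f \<star> r b g) a - (r b g \<star> f) a"
    and "(f \<star> g) (m a b) = (l a f \<star> g) b + (f \<star> r b g) a - (f \<star> l b g) a"
  using assms unfolding compatible_def by blast+

text \<open>The axioms of a perm bialgebra, paired with \<open>f \<otimes> g\<close>.\<close>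

lemma perm_bialgebra_iff_paired:
  "perm_bialgebra s m \<Delta> \<longleftrightarrow> (\<forall>a b. \<forall>f\<in>dual s. \<forall>g\<in>dual s.
     (f \<star> g) (m a b) - (g \<star> f) (m a b) = (f \<star> g) (m b a) - (g \<star> f) (m b a) \<and>
     (f \<star> g) (m b a) - (g \<star> f) (m b a) =
       (r b f \<star> g) a - (g \<star> r b f) a + (f \<star> r a g) b - (r a g \<star> f) b \<and>
     (f \<star> g) (m a b) = (l a f \<star> g) b + (f \<star> r b g) a - (f \<star> l b g) a \<and>
     (f \<star> g) (m a b) = (l a f \<star> g) b - (g \<star> l a f) b + (f \<star> r b g) a \<and>
     (f \<star> g) (m a b) = (r b f \<star> g) a + (f \<star> r a g) b - (f \<star> l a g) b
       - (r a g \<star> f) b + (l a g \<star> f) b)"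
proof -
  have functional: "bilin_functional s (\<Delta> a)" "bilin_functional s (flip2 (\<Delta> a))"
    "bilin_functional s (tensor_map s id (\<lambda>y. m b y) (\<Delta> a))"
    "bilin_functional s (tensor_map s (\<lambda>y. m b y) id (\<Delta> a))"
    "bilin_functional s (tensor_map s id (\<lambda>y. m y b) (\<Delta> a))"
    "bilin_functional s (tensor_map s (\<lambda>y. m y b) id (\<Delta> a))" for a b
    by (intro bilin_functional_closed[OF vs] Delta_functional linear_m linear_id)+
  have pairing: "pair2 f g (tensor_map s id (\<lambda>y. m b y) (\<Delta> a)) = (f \<star> l b g) a"
    "pair2 f g (tensor_map s (\<lambda>y. m b y) id (\<Delta> a)) = (l b f \<star> g) a"
    "pair2 f g (tensor_map s id (\<lambda>y. m y b) (\<Delta> a)) = (f \<star> r b g) a"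
    "pair2 f g (tensor_map s (\<lambda>y. m y b) id (\<Delta> a)) = (r b f \<star> g) a"
    if "f \<in> dual s" "g \<in> dual s" for f g a b
    using that by (simp_all add: pair2_tensor_map dual_mult_def lstar_def rstar_def)
  show ?thesis
    unfolding perm_bialgebra_def Let_def
    by (simp add: perm_m comult coassociative tensor_eq_iff functional bilin_functional_closed(1-3)[OF vs]
        pair2_simps pairing all_conj_distrib ball_conj_distrib)
qed

text \<open>
  The right-hand side of the derivation rule changes sign when \<open>a\<close>, \<open>b\<close> and \<open>f\<close>, \<open>g\<close> are both
  exchanged, while its left-hand side is antisymmetric in \<open>f\<close>, \<open>g\<close>.
\<close>

lemma compatible_commutator:
  assumes compatible "f \<in> dual s" "g \<in> dual s"
  shows "(f \<star> g) (m a b) - (g \<star> f) (m a b) = (f \<star> g) (m b a) - (g \<star> f) (m b a)"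
  using compatibleD(2)[OF assms(1,3,2), of a b] compatibleD(2)[OF assms, of b a] by algebra

lemma perm_bialgebra_iff: "perm_bialgebra s m \<Delta> \<longleftrightarrow> compatible"
proof
  assume "perm_bialgebra s m \<Delta>"
  note P = this[unfolded perm_bialgebra_iff_paired, rule_format]
  show compatible
    unfolding compatible_def
  proof (intro ballI allI)
    fix f g a b assume fg: "f \<in> dual s" "g \<in> dual s"
    show "(f \<star> l a g) b = (g \<star> l b f) a \<and>
      (f \<star> g) (m a b) - (g \<star> f) (m a b) =
        (r a f \<star> g) b - (g \<star> r a f) b + (f \<star> r b g) a - (r b g \<star> f) a \<and>
      (f \<star> g) (m a b) = (l a f \<star> g) b + (f \<star> r b g) a - (f \<star> l b g) a"
    proof (intro conjI)
      show "(f \<star> l a g) b = (g \<star> l b f) a"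
      proof -
        have "(f \<star> g) (m b a) = (l b f \<star> g) a + (f \<star> r a g) b - (f \<star> l a g) b"
          and "(f \<star> g) (m b a) = (l b f \<star> g) a - (g \<star> l b f) a + (f \<star> r a g) b"
          using P[OF fg, of b a] by blast+
        then show ?thesis by algebra
      qed
      show "(f \<star> g) (m a b) - (g \<star> f) (m a b) =
          (r a f \<star> g) b - (g \<star> r a f) b + (f \<star> r b g) a - (r b g \<star> f) a"
        using P[OF fg, of b a] by blast
      show "(f \<star> g) (m a b) = (l a f \<star> g) b + (f \<star> r b g) a - (f \<star> l b g) a"
        using P[OF fg, of a b] by blast
    qed
  qed
next
  assume c: compatible
  show "perm_bialgebra s m \<Delta>"
    unfolding perm_bialgebra_iff_paired
  proof (intro ballI allI)
    fix f g a b assume fg: "f \<in> dual s" "g \<in> dual s"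
    note fg' = fg(2,1)
    show "(f \<star> g) (m a b) - (g \<star> f) (m a b) = (f \<star> g) (m b a) - (g \<star> f) (m b a) \<and>
     (f \<star> g) (m b a) - (g \<star> f) (m b a) =
       (r b f \<star> g) a - (g \<star> r b f) a + (f \<star> r a g) b - (r a g \<star> f) b \<and>
     (f \<star> g) (m a b) = (l a f \<star> g) b + (f \<star> r b g) a - (f \<star> l b g) a \<and>
     (f \<star> g) (m a b) = (l a f \<star> g) b - (g \<star> l a f) b + (f \<star> r b g) a \<and>
     (f \<star> g) (m a b) = (r b f \<star> g) a + (f \<star> r a g) b - (f \<star> l a g) b
       - (r a g \<star> f) b + (l a g \<star> f) b"
    proof (intro conjI)
      note S = compatibleD(1)[OF c] and D = compatibleD(2)[OF c] and T = compatibleD(3)[OF c]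
      show "(f \<star> g) (m a b) - (g \<star> f) (m a b) = (f \<star> g) (m b a) - (g \<star> f) (m b a)"
        by (rule compatible_commutator[OF c fg])
      show "(f \<star> g) (m b a) - (g \<star> f) (m b a) =
          (r b f \<star> g) a - (g \<star> r b f) a + (f \<star> r a g) b - (r a g \<star> f) b"
        using D[OF fg] .
      show "(f \<star> g) (m a b) = (l a f \<star> g) b + (f \<star> r b g) a - (f \<star> l b g) a"
        using T[OF fg] .
      show "(f \<star> g) (m a b) = (l a f \<star> g) b - (g \<star> l a f) b + (f \<star> r b g) a"
        using T[OF fg, of a b] S[OF fg', of a b] by algebra
      show "(f \<star> g) (m a b) = (r b f \<star> g) a + (f \<star> r a g) b - (f \<star> l a g) b
          - (r a g \<star> f) b + (l a g \<star> f) b"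
        using D[OF fg', of a b] T[OF fg', of a b] S[OF fg, of a b] by algebra
    qed
  qed
qed

section \<open>The product on the direct sum\<close>

lemma L_R_zero: "R 0 a = 0" "L 0 a = 0" "f \<in> dual s \<Longrightarrow> R f 0 = 0" "f \<in> dual s \<Longrightarrow> L f 0 = 0"
  by (simp_all add: eq_iff_dual eval_L_R dual_apply star_zero)

lemma L_R_bilinear:
  assumes "f \<in> dual s"
  shows "g \<in> dual s \<Longrightarrow> R (f + g) a = R f a + R g a" "g \<in> dual s \<Longrightarrow> L (f + g) a = L f a + L g a"
    "R f (a + b) = R f a + R f b" "L f (a + b) = L f a + L f b"
    "R (fun_scale c f) a = s c (R f a)" "L (fun_scale c f) a = s c (L f a)"
    "R f (s c a) = s c (R f a)" "L f (s c a) = s c (L f a)"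
  using assms
  by (simp_all add: eq_iff_dual eval_L_R dual_apply star_bilinear fun_scale_def[of _ "_ \<star> _"])

text \<open>
  The product on \<open>A \<oplus> A*\<close> given by the actions \<open>r - l\<close>, \<open>r\<close> of \<open>A\<close> and \<open>R - L\<close>, \<open>R\<close> of \<open>A*\<close>.
\<close>

abbreviation double_mult (infixl "\<diamondop>" 70) where
  "double_mult \<equiv> sum_mult m (dual_mult \<Delta>) (\<lambda>a. r a - l a) r (\<lambda>f. R f - L f) R"

lemma double_mult_apply:
  "(a, f) \<diamondop> (b, g) = (m a b + (R f b - L f b) + R g a, f \<star> g + (r a g - l a g) + r b f)"
  by (simp add: sum_mult_def)

lemma lstar_rstar_zero:
  "f \<in> dual s \<Longrightarrow> l 0 f = 0" "f \<in> dual s \<Longrightarrow> r 0 f = 0" "l a 0 = 0" "r a 0 = 0"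
  by (simp_all add: fun_eq_iff lstar_rstar_apply m_diff_zero dual_apply)

lemma lstar_rstar_bilinear:
  assumes "f \<in> dual s"
  shows "l (a + b) f = l a f + l b f" "r (a + b) f = r a f + r b f"
    "l (s c a) f = fun_scale c (l a f)" "r (s c a) f = fun_scale c (r a f)"
    "l a (g + h) = l a g + l a h" "r a (g + h) = r a g + r a h"
    "l a (fun_scale c g) = fun_scale c (l a g)" "r a (fun_scale c g) = fun_scale c (r a g)"
  using assms
  by (simp_all add: fun_eq_iff lstar_rstar_apply m_bilinear dual_apply fun_scale_def)

lemma eval_m_L_R:
  assumes "f \<in> dual s" "g \<in> dual s"
  shows "g (m a (R f b)) = (l a g \<star> f) b" "g (m (R f b) a) = (r a g \<star> f) b"
    "g (m a (L f b)) = (f \<star> l a g) b" "g (m (L f b) a) = (f \<star> r a g) b"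
  using assms eval_L_R[of f "l a g"] eval_L_R[of f "r a g"] by (simp_all add: lstar_rstar_apply)

lemma bilinear_double: "bilinear_on scale (UNIV \<times> dual s) scale (UNIV \<times> dual s) scale (UNIV \<times> dual s) (\<diamondop>)"
  by (auto simp: bilinear_on_def double_mult_apply scale_prod m_bilinear star_bilinear L_R_bilinear
     lstar_rstar_bilinear vs1.scale_right_distrib f.scale_right_distrib
     vs1.scale_right_diff_distrib f.scale_right_diff_distrib)


lemma double_mult_closed: "x \<in> UNIV \<times> dual s \<Longrightarrow> y \<in> UNIV \<times> dual s \<Longrightarrow> x \<diamondop> y \<in> UNIV \<times> dual s"
  using bilinear_double unfolding bilinear_on_def by blast

text \<open>
  With these rules an identity between products in \<open>A \<oplus> A*\<close> becomes one between scalars, in which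
  every mixed term has the form \<open>(f \<star> g) (m a b)\<close> or \<open>(f \<star> g) a\<close> with \<open>l\<close> or \<open>r\<close> applied to
  \<open>f\<close> or \<open>g\<close>.
\<close>

lemmas double_simps = double_mult_apply L_R_zero star_zero lstar_rstar_zero m_diff_zero m_bilinear
  eq_iff_dual fun_eq_iff dual_apply eval_L_R eval_m_L_R star_diff star_bilinear lstar_rstar_apply

lemma perm_triple_pure:
  "perm_triple (\<diamondop>) (a, 0) (b, 0) (c, 0)"
  "f \<in> dual s \<Longrightarrow> g \<in> dual s \<Longrightarrow> h \<in> dual s \<Longrightarrow> perm_triple (\<diamondop>) (0, f) (0, g) (0, h)"
  by (simp_all add: perm_triple_def double_simps m_perm star_perm)

lemma perm_triple_aaf:
  assumes "f \<in> dual s"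
  shows "perm_triple (\<diamondop>) (a, 0) (b, 0) (0, f) \<longleftrightarrow>
    (\<forall>g\<in>dual s. (g \<star> f) (m a b) = (l a g \<star> f) b + (g \<star> r b f) a - (g \<star> l b f) a) \<and>
    (\<forall>g\<in>dual s. (g \<star> l b f) a = (f \<star> l a g) b)"
  using assms by (simp add: perm_triple_def double_simps m_perm add_diff_eq)

lemma perm_triple_faa:
  assumes "f \<in> dual s"
  shows "perm_triple (\<diamondop>) (0, f) (a, 0) (b, 0) \<longleftrightarrow>
    (\<forall>g\<in>dual s. (r b g \<star> f) a - (f \<star> r b g) a + ((g \<star> r a f) b - (r a f \<star> g) b) =
      (g \<star> f) (m a b) - (f \<star> g) (m a b)) \<and>
    (\<forall>g\<in>dual s. (g \<star> f) (m a b) - (f \<star> g) (m a b) = (g \<star> f) (m b a) - (f \<star> g) (m b a))"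
  using assms by (simp add: perm_triple_def double_simps m_perm)

lemma perm_triple_mixed:
  assumes c: compatible and f: "f \<in> dual s"
  shows "perm_triple (\<diamondop>) (a, 0) (b, 0) (0, f)"
    and "perm_triple (\<diamondop>) (a, 0) (0, f) (b, 0)"
    and "perm_triple (\<diamondop>) (0, f) (a, 0) (b, 0)"
    and "g \<in> dual s \<Longrightarrow> perm_triple (\<diamondop>) (a, 0) (0, f) (0, g)"
    and "g \<in> dual s \<Longrightarrow> perm_triple (\<diamondop>) (0, f) (a, 0) (0, g)"
    and "g \<in> dual s \<Longrightarrow> perm_triple (\<diamondop>) (0, f) (0, g) (a, 0)"
proof -
  note S = compatibleD(1)[OF c] and D = compatibleD(2)[OF c] and T = compatibleD(3)[OF c]
    and C = compatible_commutator[OF c]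
  show "perm_triple (\<diamondop>) (a, 0) (b, 0) (0, f)"
    unfolding perm_triple_aaf[OF f] using f T S by blast
  have "(r b g \<star> f) a - (f \<star> r b g) a + ((g \<star> r a f) b - (r a f \<star> g) b) =
      (g \<star> f) (m a b) - (f \<star> g) (m a b)" if "g \<in> dual s" for g
    using D[OF f that, of a b] by algebra
  then show "perm_triple (\<diamondop>) (0, f) (a, 0) (b, 0)"
    unfolding perm_triple_faa[OF f] using C f by blast
  have "(r b g \<star> f) a + ((g \<star> r a f) b - (g \<star> l a f) b - ((r a f \<star> g) b - (l a f \<star> g) b)) =
      (l a g \<star> f) b - (f \<star> l a g) b + (g \<star> r b f) a" if g: "g \<in> dual s" for g
    using D[OF f g, of a b] T[OF f g, of a b] T[OF g f, of a b] S[OF f g, of a b] S[OF g f, of a b]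
    by algebra
  then show "perm_triple (\<diamondop>) (a, 0) (0, f) (b, 0)"
    using f S[OF f, of _ a b] by (simp add: perm_triple_def double_simps m_perm)
  assume g: "g \<in> dual s"
  have "(r a f \<star> g) x - (l a f \<star> g) x + ((l x g \<star> f) a - (r x g \<star> f) a) =
      (f \<star> g) (m x a) - (f \<star> g) (m a x)" for x
    using D[OF f g, of a x] T[OF f g, of a x] T[OF g f, of x a] S[OF g f, of a x] C[OF f g, of a x]
    by algebra
  moreover have "(f \<star> g) (m x a) - (f \<star> g) (m a x) = (g \<star> f) (m x a) - (g \<star> f) (m a x)" for x
    using C[OF f g, of x a] by algebra
  ultimately show "perm_triple (\<diamondop>) (a, 0) (0, f) (0, g)"
    using f g by (simp add: perm_triple_def double_simps star_perm)
  have "(r a f \<star> g) x + ((l x g \<star> f) a - (f \<star> l x g) a - ((r x g \<star> f) a - (f \<star> r x g) a)) =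
      (f \<star> r a g) x - (f \<star> l a g) x + (l x f \<star> g) a" for x
    using D[OF f g, of a x] T[OF g f, of x a] T[OF f g, of x a] S[OF g f, of a x] C[OF f g, of a x]
    by algebra
  then show "perm_triple (\<diamondop>) (0, f) (a, 0) (0, g)"
    using f g S[OF f g, of a] by (simp add: perm_triple_def double_simps star_perm)
  have "(f \<star> g) (m x a) = (f \<star> r a g) x + ((l x f \<star> g) a - (g \<star> l x f) a)" for x
    using T[OF f g, of x a] S[OF g f, of x a] by algebra
  then show "perm_triple (\<diamondop>) (0, f) (0, g) (a, 0)"
    using f g S[OF g f, of _ a] by (simp add: perm_triple_def double_simps star_perm)
qed

lemma perm_algebra_double_iff:
  "perm_algebra scale (UNIV \<times> dual s) (\<diamondop>) \<longleftrightarrow> compatible"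
proof
  assume perm: "perm_algebra scale (UNIV \<times> dual s) (\<diamondop>)"
  then have triple: "perm_triple (\<diamondop>) (a, f) (b, g) (c, h)"
    if "f \<in> dual s" "g \<in> dual s" "h \<in> dual s" for a b c f g h
    using that unfolding perm_algebra_def perm_triple_def by blast
  show compatible
    unfolding compatible_def
  proof (intro ballI allI conjI)
    fix f g a b assume f: "f \<in> dual s" and g: "g \<in> dual s"
    \<comment> \<open>The types A,A,A* and A*,A,A already yield all three identities.\<close>
    have aaf: "perm_triple (\<diamondop>) (a, 0) (b, 0) (0, g)" and faa: "perm_triple (\<diamondop>) (0, f) (a, 0) (b, 0)"
      using triple f g by simp_all
    show "(f \<star> l a g) b = (g \<star> l b f) a"
      using triple[of 0 0 f a b 0] f g by (simp add: perm_triple_aaf)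
    show "(f \<star> g) (m a b) - (g \<star> f) (m a b) =
        (r a f \<star> g) b - (g \<star> r a f) b + (f \<star> r b g) a - (r b g \<star> f) a"
    proof -
      have "(r b g \<star> f) a - (f \<star> r b g) a + ((g \<star> r a f) b - (r a f \<star> g) b) =
          (g \<star> f) (m a b) - (f \<star> g) (m a b)"
        using faa g unfolding perm_triple_faa[OF f] by blast
      then show ?thesis by algebra
    qed
    show "(f \<star> g) (m a b) = (l a f \<star> g) b + (f \<star> r b g) a - (f \<star> l b g) a"
      using aaf f unfolding perm_triple_aaf[OF g] by blast
  qed
next
  assume c: compatible
  let ?P = "UNIV \<times> dual s"
  note add = perm_triple_add[OF bilinear_double]
  have "perm_triple (\<diamondop>) ((a, 0) + (0, f)) ((b, 0) + (0, g)) ((c, 0) + (0, h))"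
    if fgh: "f \<in> dual s" "g \<in> dual s" "h \<in> dual s" for a b c f g h
    by (intro add perm_triple_pure perm_triple_mixed[OF c]) (use fgh in simp_all)
  then have "perm_triple (\<diamondop>) x y z" if "x \<in> ?P" "y \<in> ?P" "z \<in> ?P" for x y z
    using that by (cases x; cases y; cases z) simp
  then show "perm_algebra scale ?P (\<diamondop>)"
    unfolding perm_algebra_def perm_triple_def[symmetric]
    using bilinear_double p.vector_space_axioms
      subspace_Times[OF vs1.subspace_UNIV subspace_dual[OF vs]] by (intro conjI ballI)
qed

section \<open>Matched pairs and Manin triples\<close>

lemma matched_pair_iff:
  "matched_pair s UNIV m fun_scale (dual s) (dual_mult \<Delta>)
     (\<lambda>a. r a - l a) r (\<lambda>f. R f - L f) R \<longleftrightarrow> perm_algebra scale (UNIV \<times> dual s) (\<diamondop>)"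
proof -
  have "bilinear_on s UNIV fun_scale (dual s) fun_scale (dual s) (\<lambda>a. r a - l a)"
    "bilinear_on s UNIV fun_scale (dual s) fun_scale (dual s) r"
    by (simp_all add: bilinear_on_def lstar_rstar_bilinear f.scale_right_diff_distrib)
  moreover have "bilinear_on fun_scale (dual s) s UNIV s UNIV (\<lambda>f. R f - L f)"
    "bilinear_on fun_scale (dual s) s UNIV s UNIV R"
    by (simp_all add: bilinear_on_def L_R_bilinear vs1.scale_right_diff_distrib)
  ultimately show ?thesis
    unfolding matched_pair_def using perm_m perm_star by (simp only: simp_thms)
qed

lemma invariant_double: "invariant_form (UNIV \<times> dual s) (\<diamondop>) omega_hat"
  by (auto simp: invariant_form_def omega_hat_def double_mult_apply dual_apply eval_L_R lstar_rstar_apply)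

text \<open>
  Invariance leaves no freedom for the mixed products: testing \<open>M (a, 0) (0, f)\<close> and
  \<open>M (0, f) (a, 0)\<close> against \<open>A\<close> and against \<open>A*\<close> expresses their components through the products
  inside \<open>A\<close> and inside \<open>A*\<close>.
\<close>

lemma invariant_extension_unique:
  assumes bil: "bilinear_on scale (UNIV \<times> dual s) scale (UNIV \<times> dual s) scale (UNIV \<times> dual s) M"
    and M_A: "\<And>a b. M (a, 0) (b, 0) = (m a b, 0)"
    and M_dual: "\<And>f g. f \<in> dual s \<Longrightarrow> g \<in> dual s \<Longrightarrow> M (0, f) (0, g) = (0, f \<star> g)"
    and inv: "invariant_form (UNIV \<times> dual s) M omega_hat"
    and x: "x \<in> UNIV \<times> dual s" and y: "y \<in> UNIV \<times> dual s"
  shows "M x y = x \<diamondop> y"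
proof -
  let ?P = "UNIV \<times> dual s"
  have closed: "M x y \<in> ?P" if "x \<in> ?P" "y \<in> ?P" for x y
    using bil that unfolding bilinear_on_def by blast
  have add: "M (x + x') y = M x y + M x' y" "M y (x + x') = M y x + M y x'"
    if "x \<in> ?P" "x' \<in> ?P" "y \<in> ?P" for x x' y
    using bil that unfolding bilinear_on_def by blast+
  have mixed: "M (a, 0) (0, f) = (R f a, r a f - l a f)" "M (0, f) (a, 0) = (R f a - L f a, r a f)"
    if f: "f \<in> dual s" for a f
  proof -
    have "M (a, 0) (0, f) \<in> UNIV \<times> dual s" "M (0, f) (a, 0) \<in> UNIV \<times> dual s"
      using f by (simp_all add: closed)
    then obtain u v u' v' where uv: "M (a, 0) (0, f) = (u, v)" "M (0, f) (a, 0) = (u', v')"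
      and dual: "v \<in> dual s" "v' \<in> dual s"
      by blast
    note inv' = inv[unfolded invariant_form_def, rule_format]
    \<comment> \<open>Each instance of invariance below determines one further component.\<close>
    have u': "h u' = (h \<star> f) a - (f \<star> h) a" if "h \<in> dual s" for h
      using inv'[of "(0, f)" "(a, 0)" "(0, h)"] f that dual
      by (simp add: uv M_dual omega_hat_def dual_apply)
    have u: "h u = (h \<star> f) a" if "h \<in> dual s" for h
    proof -
      have "- (f \<star> h) a = h u' - h u"
        using inv'[of "(0, f)" "(0, h)" "(a, 0)"] f that dual
        by (simp add: uv M_dual omega_hat_def dual_apply)
      then show ?thesis using u'[OF that] by algebra
    qed
    have v: "v b = f (m b a) - f (m a b)" for b
      using inv'[of "(a, 0)" "(0, f)" "(b, 0)"] f dual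
      by (simp add: uv M_A omega_hat_def dual_apply) algebra
    have v': "v' b = f (m b a)" for b
      using inv'[of "(a, 0)" "(b, 0)" "(0, f)"] f dual v[of b]
      by (simp add: uv M_A omega_hat_def dual_apply)
    show "M (a, 0) (0, f) = (R f a, r a f - l a f)" "M (0, f) (a, 0) = (R f a - L f a, r a f)"
      using f by (simp_all add: uv eq_iff_dual fun_eq_iff u u' v v' dual_apply eval_L_R lstar_rstar_apply)
  qed
  obtain a f b g where xy: "x = (a, 0) + (0, f)" "y = (b, 0) + (0, g)" "f \<in> dual s" "g \<in> dual s"
    using x y by auto
  have "M x y = M (a, 0) (b, 0) + M (a, 0) (0, g) + (M (0, f) (b, 0) + M (0, f) (0, g))"
    using x y xy(3,4) unfolding xy(1,2) by (simp add: add del: add_Pair)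
  then show ?thesis
    using xy by (simp add: M_A M_dual mixed double_mult_apply add_ac)
qed

lemma standard_manin_triple_iff:
  "standard_manin_triple s m (dual_mult \<Delta>) \<longleftrightarrow> perm_algebra scale (UNIV \<times> dual s) (\<diamondop>)"
proof
  assume "standard_manin_triple s m (dual_mult \<Delta>)"
  then obtain M where perm: "perm_algebra scale (UNIV \<times> dual s) M"
    and M: "\<And>a b. M (a, 0) (b, 0) = (m a b, 0)"
      "\<And>f g. f \<in> dual s \<Longrightarrow> g \<in> dual s \<Longrightarrow> M (0, f) (0, g) = (0, f \<star> g)"
      "invariant_form (UNIV \<times> dual s) M omega_hat"
    unfolding standard_manin_triple_def by blast
  have bil: "bilinear_on scale (UNIV \<times> dual s) scale (UNIV \<times> dual s) scale (UNIV \<times> dual s) M"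
    using perm by (simp add: perm_algebra_def)
  note eq = invariant_extension_unique[OF bil M]
  show "perm_algebra scale (UNIV \<times> dual s) (\<diamondop>)"
    unfolding perm_algebra_def
  proof (intro conjI ballI bilinear_double)
    show "vector_space scale" "p.subspace (UNIV \<times> dual s)"
      using perm by (simp_all add: perm_algebra_def)
    fix x y z :: "'a \<times> ('a \<Rightarrow> 'k)"
    assume xyz: "x \<in> UNIV \<times> dual s" "y \<in> UNIV \<times> dual s" "z \<in> UNIV \<times> dual s"
    then have "M (M x y) z = M x (M y z)" "M x (M y z) = M x (M z y)"
      using perm unfolding perm_algebra_def by blast+
    moreover have "M (M x y) z = x \<diamondop> y \<diamondop> z" "M x (M y z) = x \<diamondop> (y \<diamondop> z)" "M x (M z y) = x \<diamondop> (z \<diamondop> y)"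
      using xyz by (simp_all only: eq double_mult_closed)
    ultimately show "x \<diamondop> y \<diamondop> z = x \<diamondop> (y \<diamondop> z)" "x \<diamondop> (y \<diamondop> z) = x \<diamondop> (z \<diamondop> y)"
      by simp_all
  qed
next
  assume "perm_algebra scale (UNIV \<times> dual s) (\<diamondop>)"
  moreover have "(a, 0) \<diamondop> (b, 0) = (m a b, 0)" for a b
    by (simp add: double_mult_apply L_R_zero star_zero lstar_rstar_zero)
  moreover have "(0, f) \<diamondop> (0, g) = (0, f \<star> g)" if "f \<in> dual s" "g \<in> dual s" for f g
    using that by (simp add: double_mult_apply L_R_zero m_diff_zero lstar_rstar_zero)
  ultimately show "standard_manin_triple s m (dual_mult \<Delta>)"
    unfolding standard_manin_triple_def using invariant_double by blast
qed

end

section \<open>The equivalence\<close>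

theorem theorem4p11:
  fixes s :: "'k::field_char_0 \<Rightarrow> 'a::ab_group_add \<Rightarrow> 'a"
    and B :: "'a set"
    and m :: "'a \<Rightarrow> 'a \<Rightarrow> 'a"
    and \<Delta> :: "'a \<Rightarrow> ('k, 'a) tens2"
  assumes "finite_dimensional_vector_space s B"
    and "perm_algebra s UNIV m"
    and "comultiplication s \<Delta>"
    and "perm_algebra fun_scale (dual s) (dual_mult \<Delta>)"
  shows "(perm_bialgebra s m \<Delta> \<longleftrightarrow>
            matched_pair s UNIV m fun_scale (dual s) (dual_mult \<Delta>)
              (\<lambda>a. rstar m a - lstar m a) (rstar m)
              (\<lambda>b. dual_rstar s (dual_mult \<Delta>) b - dual_lstar s (dual_mult \<Delta>) b)
              (dual_rstar s (dual_mult \<Delta>)))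
       \<and> (perm_bialgebra s m \<Delta> \<longleftrightarrow> standard_manin_triple s m (dual_mult \<Delta>))"
proof -
  interpret perm_dual_pair s B m \<Delta>
    using assms by (rule perm_dual_pair.intro)
  show ?thesis
    unfolding perm_bialgebra_iff matched_pair_iff standard_manin_triple_iff perm_algebra_double_iff
    by simp
qed

end
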